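(* Let $T$ be a tiling of $\mathbb{R}^d$ ($d\geqslant2$) with finite local complexity, and suppose that $T$ is repetitive or, equivalently, that the dynamical system $(\Omega_t,\mathbb{R}^d)$ is minimal. Then $T$ has a point group $G$. Moreover, every element of $\Omega_r$ also has point group $G$.
   Context: A tiling of $\mathbb{R}^d$ is a cover of $\mathbb{R}^d$ by compact $d$-dimensional polyhedral subsets (tiles), possibly carrying labels, meeting full face to full face and only on boundaries, each tile being a translate (with matching label) of one of a finite set of prototiles. A patch is a finite set of tiles of $T$; the $r$-patch at $x$ is the set of tiles meeting the closed ball of radius $r$ at $x$; $P$ is an $r$-patch if it is the $r$-patch at some point. Finite local complexity (FLC): for each $r$ there are finitely many $r$-patches up to translation. $T$ is repetitive if for each $r>0$ there is $R_r>0$ such that every $r$-patch can be found, up to translation, within distance $R_r$ of every point of $\mathbb{R}^d$. A rigid motion is an orientation preserving isometry of $\mathbb{R}^d$, acting on tilings and patches tile by tile. $\Omega_t$ (resp. $\Omega_r$) is the space of tilings all of whose patches appear in $T$ up to translation (resp. up to rigid motion), with the topology in which two tilings are close if they agree on a large ball about the origin after a small translation followed by a small rotation of either. $\mathbb{R}^d$ acts on $\Omega_t$ by translation. A finite subgroup $G\leq\mathrm{SO}(d)$ acts on $T$ by rotations if for every patch $P$ of $T$ and $g\in G$, $g(P)$ is also a patch of $T$ up to translation. $T$ has point group $G$ if $G$ acts on $T$ by rotations and there is some $r>0$ such that whenever an $r$-patch $P$ and its rotate $g(P)$, $g\in\mathrm{SO}(d)$, both belong to $T$ up to translation, then $g\in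 G$.
   Formalization: For d ≥ 3 elements of Ω_r are shown to have point group hGh⁻¹ for some h in SO(d), not literally G: a generically rotated cube tiling of ℝ³ lies in Ω_r and has a different conjugate as point group. Equality with G is proved on Ω_t, and on Ω_r when d = 2. *)

theory Defs
  imports "HOL-Analysis.Analysis" "HOL-Algebra.Group"
begin

section \<open>Tiles and tilings\<close>

text \<open>A tile is a subset of \<open>\<real>\<^sup>d\<close> together with a label; tilings without labels are
  obtained by taking the label type to be \<^typ>\<open>unit\<close>.\<close>

type_synonym ('n, 'l) tile = "(real^'n) set \<times> 'l"
type_synonym ('n, 'l) tiling = "('n, 'l) tile set"

text \<open>Compact \<open>d\<close>-dimensional polyhedral sets, not necessarily convex or connected.\<close>

definition polyhedral_body :: "'a::euclidean_space set \<Rightarrow> bool" where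
  "polyhedral_body S \<longleftrightarrow>
     (\<exists>F. finite F \<and> F \<noteq> {} \<and> (\<forall>C\<in>F. polytope C \<and> interior C \<noteq> {}) \<and> S = \<Union>F)"

text \<open>The library's \<^const>\<open>face_of\<close> only gives a useful notion for convex sets. For polyhedral
  sets that need not be convex, an open face is a connected component of a set of points of
  \<open>S\<close> near which \<open>S\<close> looks the same up to translation, and a face is the closure of an open
  face. If \<open>S\<close> is a convex polytope, these are exactly its nonempty faces, \<open>S\<close> included.\<close>

definition same_germ :: "'a::euclidean_space set \<Rightarrow> 'a \<Rightarrow> 'a \<Rightarrow> bool" where
  "same_germ S x y \<longleftrightarrow> (\<exists>e>0. \<forall>v\<in>ball 0 e. x + v \<in> S \<longleftrightarrow> y + v \<in> S)"

definition faces :: "'a::euclidean_space set \<Rightarrow> 'a set set" where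
  "faces S = {closure (connected_component_set {y \<in> S. same_germ S x y} x) | x. x \<in> S}"

text \<open>Two nonconvex tiles may share several faces, so their intersection is required to be the
  union of the common faces. For convex polytopes this says that the intersection is empty or
  a face of both.\<close>

definition face_to_face :: "'a::euclidean_space set \<Rightarrow> 'a set \<Rightarrow> bool" where
  "face_to_face S S' \<longleftrightarrow> S \<inter> S' = \<Union>(faces S \<inter> faces S')"

definition move :: "(real^'n \<Rightarrow> real^'n) \<Rightarrow> ('n, 'l) tile set \<Rightarrow> ('n, 'l) tile set" where
  "move f P = map_prod ((`) f) id ` P"

abbreviation translate :: "real^'n \<Rightarrow> ('n, 'l) tile set \<Rightarrow> ('n, 'l) tile set" where
  "translate v \<equiv> move ((+) v)"

abbreviation rotate :: "real^'n^'n \<Rightarrow> ('n, 'l) tile set \<Rightarrow> ('n, 'l) tile set" where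
  "rotate A \<equiv> move ((*v) A)"

definition tiling :: "('n::finite, 'l) tiling \<Rightarrow> bool" where
  "tiling T \<longleftrightarrow>
     (\<forall>t\<in>T. polyhedral_body (fst t)) \<and>
     (\<Union>t\<in>T. fst t) = UNIV \<and>
     (\<forall>s\<in>T. \<forall>t\<in>T. s \<noteq> t \<longrightarrow>
        fst s \<inter> fst t \<subseteq> frontier (fst s) \<inter> frontier (fst t) \<and> face_to_face (fst s) (fst t)) \<and>
     (\<exists>Q. finite Q \<and> (\<forall>t\<in>T. \<exists>q\<in>Q. \<exists>v. t = ((+) v ` fst q, snd q)))"

section \<open>Patches\<close>

definition patch :: "('n, 'l) tiling \<Rightarrow> ('n, 'l) tile set \<Rightarrow> bool" where
  "patch T P \<longleftrightarrow> finite P \<and> P \<subseteq> T"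

definition patch_at :: "('n::finite, 'l) tiling \<Rightarrow> real \<Rightarrow> real^'n \<Rightarrow> ('n, 'l) tile set" where
  "patch_at T r x = {t \<in> T. fst t \<inter> cball x r \<noteq> {}}"

definition r_patch :: "('n::finite, 'l) tiling \<Rightarrow> real \<Rightarrow> ('n, 'l) tile set \<Rightarrow> bool" where
  "r_patch T r P \<longleftrightarrow> (\<exists>x. P = patch_at T r x)"

definition appears_up_to_translation ::
    "('n::finite, 'l) tiling \<Rightarrow> ('n, 'l) tile set \<Rightarrow> bool" where
  "appears_up_to_translation T P \<longleftrightarrow> (\<exists>v. patch T (translate v P))"

definition flc :: "('n::finite, 'l) tiling \<Rightarrow> bool" where
  "flc T \<longleftrightarrow>
     (\<forall>r>0. \<exists>F. finite F \<and> (\<forall>P. r_patch T r P \<longrightarrow> (\<exists>Q\<in>F. \<exists>v. P = translate v Q)))"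

definition repetitive :: "('n::finite, 'l) tiling \<Rightarrow> bool" where
  "repetitive T \<longleftrightarrow>
     (\<forall>r>0. \<exists>R>0. \<forall>P. r_patch T r P \<longrightarrow>
        (\<forall>y. \<exists>v. patch T (translate v P) \<and> (\<forall>t\<in>translate v P. fst t \<subseteq> cball y R)))"

section \<open>Tiling spaces\<close>

definition rigid_motion :: "(real^'n \<Rightarrow> real^'n::finite) \<Rightarrow> bool" where
  "rigid_motion f \<longleftrightarrow>
     (\<forall>x y. dist (f x) (f y) = dist x y) \<and> det (matrix (\<lambda>x. f x - f 0)) = 1"

definition appears_up_to_rigid_motion ::
    "('n::finite, 'l) tiling \<Rightarrow> ('n, 'l) tile set \<Rightarrow> bool" where
  "appears_up_to_rigid_motion T P \<longleftrightarrow> (\<exists>f. rigid_motion f \<and> patch T (move f P))"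

definition Omega_t :: "('n::finite, 'l) tiling \<Rightarrow> ('n, 'l) tiling set" where
  "Omega_t T = {S. tiling S \<and> (\<forall>P. patch S P \<longrightarrow> appears_up_to_translation T P)}"

definition Omega_r :: "('n::finite, 'l) tiling \<Rightarrow> ('n, 'l) tiling set" where
  "Omega_r T = {S. tiling S \<and> (\<forall>P. patch S P \<longrightarrow> appears_up_to_rigid_motion T P)}"

definition agree_after_small_motion ::
    "real \<Rightarrow> ('n::finite, 'l) tiling \<Rightarrow> ('n, 'l) tiling \<Rightarrow> bool" where
  "agree_after_small_motion e S S' \<longleftrightarrow>
     (\<exists>v A. norm v < e \<and> rotation_matrix A \<and> norm (A - mat 1) < e \<and>
        patch_at (rotate A (translate v S)) (1 / e) 0 = patch_at S' (1 / e) 0)"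

definition close_tilings :: "real \<Rightarrow> ('n::finite, 'l) tiling \<Rightarrow> ('n, 'l) tiling \<Rightarrow> bool" where
  "close_tilings e S S' \<longleftrightarrow> agree_after_small_motion e S S' \<or> agree_after_small_motion e S' S"

definition tiling_topology :: "('n::finite, 'l) tiling set \<Rightarrow> ('n, 'l) tiling topology" where
  "tiling_topology X =
     topology (\<lambda>U. U \<subseteq> X \<and> (\<forall>S\<in>U. \<exists>e>0. \<forall>S'\<in>X. close_tilings e S S' \<longrightarrow> S' \<in> U))"

lemma agree_after_small_motion_mono:
  assumes "agree_after_small_motion d S S'" "0 < d" "d \<le> e"
  shows "agree_after_small_motion e S S'"
proof -
  obtain v A where *: "norm v < d" "rotation_matrix A" "norm (A - mat 1) < d"
      "patch_at (rotate A (translate v S)) (1 / d) 0 = patch_at S' (1 / d) 0"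
    using assms(1) unfolding agree_after_small_motion_def by blast
  have le: "1 / e \<le> 1 / d"
    using assms by (simp add: frac_le)
  have restrict: "patch_at U (1 / e) 0 = {t \<in> patch_at U (1 / d) 0. fst t \<inter> cball 0 (1 / e) \<noteq> {}}"
    for U :: "('a, 'b) tiling"
    using subset_cball[OF le, of 0] unfolding patch_at_def by blast
  have "patch_at (rotate A (translate v S)) (1 / e) 0 = patch_at S' (1 / e) 0"
    unfolding restrict using *(4) by (simp only:)
  moreover have "norm v < e" "norm (A - mat 1) < e"
    using * assms by auto
  ultimately show ?thesis
    unfolding agree_after_small_motion_def using *(2) by blast
qed

lemma close_tilings_mono:
  "close_tilings d S S' \<Longrightarrow> 0 < d \<Longrightarrow> d \<le> e \<Longrightarrow> close_tilings e S S'"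
  unfolding close_tilings_def using agree_after_small_motion_mono by blast

lemma openin_tiling_topology:
  "openin (tiling_topology X) U \<longleftrightarrow>
     U \<subseteq> X \<and> (\<forall>S\<in>U. \<exists>e>0. \<forall>S'\<in>X. close_tilings e S S' \<longrightarrow> S' \<in> U)"
proof -
  let ?P = "\<lambda>U. U \<subseteq> X \<and> (\<forall>S\<in>U. \<exists>e>0. \<forall>S'\<in>X. close_tilings e S S' \<longrightarrow> S' \<in> U)"
  have "?P (U \<inter> V)" if U: "?P U" and V: "?P V" for U V
  proof (intro conjI ballI)
    show "U \<inter> V \<subseteq> X" using U by blast
    fix S assume S: "S \<in> U \<inter> V"
    obtain d where d: "d > 0" "\<forall>S'\<in>X. close_tilings d S S' \<longrightarrow> S' \<in> U" using U S by blast
    obtain e where e: "e > 0" "\<forall>S'\<in>X. close_tilings e S S' \<longrightarrow> S' \<in> V" using V S by blast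
    show "\<exists>e>0. \<forall>S'\<in>X. close_tilings e S S' \<longrightarrow> S' \<in> U \<inter> V"
    proof (intro exI[of _ "min d e"] conjI ballI impI)
      show "0 < min d e" using d(1) e(1) by simp
      fix S' assume S': "S' \<in> X" and "close_tilings (min d e) S S'"
      then have "close_tilings d S S'" "close_tilings e S S'"
        using d(1) e(1) by (auto intro: close_tilings_mono[of "min d e"])
      then show "S' \<in> U \<inter> V" using d(2) e(2) S' by blast
    qed
  qed
  moreover have "?P (\<Union>K)" if K: "\<forall>U\<in>K. ?P U" for K
  proof (intro conjI ballI)
    show "\<Union>K \<subseteq> X" using K by blast
    fix S assume "S \<in> \<Union>K"
    then obtain U where U: "U \<in> K" "S \<in> U" by blast
    then obtain e where "e > 0" "\<forall>S'\<in>X. close_tilings e S S' \<longrightarrow> S' \<in> U"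
      using K by meson
    then show "\<exists>e>0. \<forall>S'\<in>X. close_tilings e S S' \<longrightarrow> S' \<in> \<Union>K"
      using U(1) by (intro exI[of _ e]) blast
  qed
  ultimately have "istopology ?P"
    unfolding istopology_def by (intro conjI allI impI) simp_all
  then show ?thesis
    unfolding tiling_topology_def by (simp only: topology_inverse')
qed

text \<open>Minimality of the action of \<open>\<real>\<^sup>d\<close> on \<open>X\<close> by translation: every orbit is dense.\<close>

definition minimal_system :: "('n::finite, 'l) tiling set \<Rightarrow> bool" where
  "minimal_system X \<longleftrightarrow>
     (\<forall>S\<in>X. tiling_topology X closure_of (range (\<lambda>v. translate v S)) = X)"

section \<open>Point groups\<close>

definition SO :: "(real^'n^'n::finite) monoid" where
  "SO = \<lparr>carrier = {A. rotation_matrix A}, mult = (**), one = mat 1\<rparr>"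

definition acts_by_rotations :: "(real^'n^'n) set \<Rightarrow> ('n::finite, 'l) tiling \<Rightarrow> bool" where
  "acts_by_rotations G T \<longleftrightarrow> finite G \<and> subgroup G SO \<and>
     (\<forall>P g. patch T P \<longrightarrow> g \<in> G \<longrightarrow> appears_up_to_translation T (rotate g P))"

definition has_point_group :: "('n::finite, 'l) tiling \<Rightarrow> (real^'n^'n) set \<Rightarrow> bool" where
  "has_point_group T G \<longleftrightarrow> acts_by_rotations G T \<and>
     (\<exists>r>0. \<forall>P g. r_patch T r P \<longrightarrow> g \<in> carrier SO \<longrightarrow>
        appears_up_to_translation T (rotate g P) \<longrightarrow> g \<in> G)"

text \<open>If \<open>T\<close> has point group \<open>G\<close>, then the rotated tiling \<open>h(T)\<close> has point group \<open>h G h\<^sup>-\<^sup>1\<close>. So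
  for \<open>d > 2\<close> the tilings that appear in \<open>T\<close> only up to rigid motion have point group \<open>G\<close> up to
  conjugation in \<open>SO(d)\<close>, and not in general as the same subset of \<open>SO(d)\<close>.\<close>

definition conjugate_subgroup :: "real^'n^'n \<Rightarrow> (real^'n^'n::finite) set \<Rightarrow> (real^'n^'n) set" where
  "conjugate_subgroup h G = (\<lambda>g. h ** g ** transpose h) ` G"

end

theory Submission
  imports Defs
begin

text \<open>Two finiteness facts carry the argument. A tile is a bounded polyhedral body, and a rotation that
  carries one such body to a translate of another one permutes the vertices of the convex hulls, so
  only finitely many rotations do this (\<open>finite_rotations_between_polyhedral_bodies\<close>); there are
  finitely many prototiles, and so only finitely many rotations relate the tiles of one tiling to
  those of another. And tiles have a minimal size, so that only finitely many of them meet a ball;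
  since they are also the closures of their interiors, a tiling that contains the patch of another
  tiling at a ball has exactly this patch there (\<open>patch_at_eqI\<close>).

  If \<open>T\<close> is repetitive, every tiling in \<open>Omega_t T\<close> contains a copy of every patch of \<open>T\<close>, and this
  makes orbits dense. For the converse, finite local complexity allows one to look at a single patch.
  Suppose that it has no copy in some arbitrarily large balls of \<open>T\<close>. By finite local complexity, \<open>T\<close> seen from the centres of these balls has a limit in
  \<open>Omega_t T\<close> (\<open>flc_limit_tiling\<close>), and it does not contain the patch. To contain the patch is an open
  condition on \<open>Omega_t T\<close> (\<open>openin_fits\<close>): by the finiteness of the set of rotations, the small rotation in
  the definition of the topology must be trivial. So the orbit of the limit is not dense.

  The rotations that carry some patch of radius \<open>n\<close> of \<open>T\<close> to a patch of \<open>T\<close> form a finite set that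
  decreases with \<open>n\<close>; the set at which this sequence becomes constant is the point group of a
  repetitive \<open>T\<close> (\<open>repetitive_has_point_group\<close>). It depends only on the patches up to translation and is
  shared by the tilings in \<open>Omega_t T\<close>. The same compactness of a decreasing sequence of finite sets of
  rotations shows that each tiling in \<open>Omega_r T\<close> is a rotate of a tiling in \<open>Omega_t T\<close>
  (\<open>Omega_r_rotation\<close>), and rotating a tiling conjugates its point group. In the plane rotations
  commute, so the conjugate is the group itself.\<close>

section \<open>Rotations and rigid motions\<close>

text \<open>The equation \<open>transpose A *v x = x v* A\<close> would turn inverse rotations into row vector
  products.\<close>

declare transpose_matrix_vector [simp del]

lemma rotation_matrix_mat_1: "rotation_matrix (mat 1)"
  by (simp add: rotation_matrix_def orthogonal_matrix_id)

lemma rotation_matrix_mult: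
  fixes A B :: "real^'n^'n"
  shows "rotation_matrix A \<Longrightarrow> rotation_matrix B \<Longrightarrow> rotation_matrix (A ** B)"
  by (simp add: rotation_matrix_def orthogonal_matrix_mul det_mul)

lemma rotation_matrix_transpose: "rotation_matrix A \<Longrightarrow> rotation_matrix (transpose A)"
  by (simp add: rotation_matrix_def)

lemma rotation_matrix_transpose_mult:
  assumes "rotation_matrix A"
  shows "transpose A ** A = mat 1" "A ** transpose A = mat 1"
  using assms by (simp_all add: rotation_matrix_def orthogonal_matrix_def)

lemma carrier_SO: "carrier SO = {A. rotation_matrix A}"
  by (simp add: SO_def)

lemma group_SO: "group SO"
proof (rule groupI)
  show "\<exists>y\<in>carrier SO. y \<otimes>\<^bsub>SO\<^esub> x = \<one>\<^bsub>SO\<^esub>" if "x \<in> carrier SO" for x :: "real^'a^'a"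
    using that rotation_matrix_transpose rotation_matrix_transpose_mult(1)
    by (auto simp: SO_def intro!: bexI[of _ "transpose x"])
qed (auto simp: SO_def rotation_matrix_mat_1 rotation_matrix_mult matrix_mul_assoc)

lemma inv_SO:
  assumes "rotation_matrix A"
  shows "inv\<^bsub>SO\<^esub> A = transpose A"
  using group.inv_equality[OF group_SO, of "transpose A" A] assms
  by (simp add: SO_def rotation_matrix_transpose rotation_matrix_transpose_mult)

lemma subgroup_SO_iff:
  "subgroup G SO \<longleftrightarrow> (\<forall>A\<in>G. rotation_matrix A) \<and> mat 1 \<in> G \<and>
     (\<forall>A\<in>G. \<forall>B\<in>G. A ** B \<in> G) \<and> (\<forall>A\<in>G. transpose A \<in> G)"
proof -
  have "(\<forall>A\<in>G. inv\<^bsub>SO\<^esub> A \<in> G) \<longleftrightarrow> (\<forall>A\<in>G. transpose A \<in> G)" if "\<forall>A\<in>G. rotation_matrix A"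
    using that by (simp add: inv_SO)
  then show ?thesis
    unfolding subgroup_def by (auto simp: SO_def)
qed

text \<open>A finite set of rotations closed under products is closed under inverses, because
  multiplication by one of its elements permutes it.\<close>

lemma finite_closed_imp_subgroup_SO:
  assumes "finite G" "\<And>A. A \<in> G \<Longrightarrow> rotation_matrix A" "mat 1 \<in> G"
    and closed: "\<And>A B. A \<in> G \<Longrightarrow> B \<in> G \<Longrightarrow> A ** B \<in> G"
  shows "subgroup G SO"
proof -
  have "transpose A \<in> G" if A: "A \<in> G" for A
  proof -
    have tA: "transpose A ** A = mat 1"
      using assms(2)[OF A] rotation_matrix_transpose_mult by blast
    have "inj_on ((**) A) G"
      by (metis inj_onI matrix_mul_assoc matrix_mul_lid tA)
    then have "(**) A ` G = G"
      using endo_inj_surj[OF \<open>finite G\<close>] closed[OF A] by blast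
    then obtain B where "B \<in> G" "A ** B = mat 1"
      using \<open>mat 1 \<in> G\<close> by (metis imageE)
    then show ?thesis
      by (metis matrix_mul_assoc matrix_mul_lid matrix_mul_rid tA)
  qed
  then show ?thesis
    using assms by (simp add: subgroup_SO_iff)
qed

text \<open>The orientation preserving motion \<open>x \<mapsto> v + A x\<close>. Translations and rotations about the origin
  are the cases \<open>A = 1\<close> and \<open>v = 0\<close>.\<close>

definition motion :: "real^'n^'n \<Rightarrow> real^'n \<Rightarrow> real^'n \<Rightarrow> real^'n::finite" where
  "motion A v x = v + A *v x"

lemma translation_eq_motion: "(+) v = motion (mat 1) v"
  by (simp add: motion_def fun_eq_iff)

lemma rotation_eq_motion: "(*v) A = motion A 0"
  by (simp add: motion_def fun_eq_iff)

lemma motion_comp: "motion A v \<circ> motion B w = motion (A ** B) (v + A *v w)"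
  by (simp add: motion_def fun_eq_iff matrix_vector_right_distrib matrix_vector_mul_assoc)

lemma motion_mat_1_0: "motion (mat 1) 0 = id"
  by (simp add: motion_def fun_eq_iff)

lemma orthogonal_transformation_rotation:
  fixes A :: "real^'n^'n"
  assumes "rotation_matrix A"
  shows "orthogonal_transformation ((*v) A)"
  using assms by (simp add: orthogonal_transformation_matrix rotation_matrix_def)

lemma motion_inverse:
  assumes "rotation_matrix A"
  shows "motion A v \<circ> motion (transpose A) (- (transpose A *v v)) = id"
    and "motion (transpose A) (- (transpose A *v v)) \<circ> motion A v = id"
proof -
  have *: "A *v (transpose A *v v) = v"
    by (simp add: matrix_vector_mul_assoc rotation_matrix_transpose_mult[OF assms])
  show "motion A v \<circ> motion (transpose A) (- (transpose A *v v)) = id"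
    unfolding motion_comp linear_neg[OF matrix_vector_mul_linear] *
    by (simp add: rotation_matrix_transpose_mult[OF assms] motion_mat_1_0)
  show "motion (transpose A) (- (transpose A *v v)) \<circ> motion A v = id"
    unfolding motion_comp
    by (simp add: rotation_matrix_transpose_mult[OF assms] motion_mat_1_0)
qed

lemma bij_motion: "rotation_matrix A \<Longrightarrow> bij (motion A v)"
  using motion_inverse o_bij by blast

lemma inj_motion: "rotation_matrix A \<Longrightarrow> inj (motion A v)"
  using bij_motion bij_is_inj by blast

lemma dist_motion:
  assumes "rotation_matrix A"
  shows "dist (motion A v x) (motion A v y) = dist x y"
  using orthogonal_transformation_isometry[THEN iffD1, OF orthogonal_transformation_rotation[OF assms]]
  by (simp add: motion_def)

lemma rigid_motion_eq_motion:
  assumes "rigid_motion f"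
  obtains A v where "rotation_matrix A" "f = motion A v"
proof
  let ?L = "\<lambda>x. f x - f 0"
  have L: "orthogonal_transformation ?L"
    using assms by (simp add: orthogonal_transformation_isometry rigid_motion_def dist_norm)
  then show "rotation_matrix (matrix ?L)"
    using assms by (simp add: orthogonal_transformation_matrix rotation_matrix_def rigid_motion_def)
  have "matrix ?L *v x = ?L x" for x
    using L orthogonal_transformation_linear by (metis matrix_vector_mul)
  then show "f = motion (matrix ?L) (f 0)"
    by (simp add: motion_def fun_eq_iff)
qed

text \<open>The plane rotations commute: a rotation matrix of size two has the rows \<open>(c, -s)\<close> and
  \<open>(s, c)\<close>.\<close>

lemma rotation_matrix_commute_card_2:
  fixes A B :: "real^'n^'n::finite"
  assumes "CARD('n) = 2" "rotation_matrix A" "rotation_matrix B"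
  shows "A ** B = B ** A"
proof -
  obtain i j :: 'n where ij: "UNIV = {i, j}" "i \<noteq> j"
    using assms(1) by (meson card_2_iff)
  have sum_ij: "(\<Sum>k\<in>UNIV. f k) = f i + f j" for f :: "'n \<Rightarrow> real"
    unfolding ij(1) using ij(2) by simp
  have entries: "C$j$j = C$i$i \<and> C$i$j = - C$j$i" if C: "rotation_matrix C" for C :: "real^'n^'n"
  proof -
    have "finite {j}" "i \<notin> {j}"
      using ij by auto
    note perm = sum_over_permutations_insert[OF this]
    have det: "C$i$i * C$j$j - C$i$j * C$j$i = 1"
      using C ij(2) unfolding rotation_matrix_def det_def ij(1) perm permutes_sing
      by (simp add: sign_swap_id sign_id swap_id_eq)
    have "transpose C ** C = mat 1"
      using C rotation_matrix_transpose_mult by blast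
    then have "(transpose C ** C)$k$l = (mat 1 :: real^'n^'n)$k$l" for k l
      by simp
    from this[of i i] this[of j j]
    have rows: "C$i$i * C$i$i + C$j$i * C$j$i = 1" "C$i$j * C$i$j + C$j$j * C$j$j = 1"
      by (simp_all add: matrix_matrix_mult_def transpose_def mat_def sum_ij)
    \<comment> \<open>the left-hand side is the sum of the squared column norms minus twice the determinant\<close>
    have "(C$j$j - C$i$i)\<^sup>2 + (C$i$j + C$j$i)\<^sup>2 = 0"
      using det rows by (simp add: power2_eq_square algebra_simps)
    then show ?thesis
      by (simp add: sum_power2_eq_zero_iff)
  qed
  have "(A ** B)$k$l = (B ** A)$k$l" for k l
  proof -
    have "k \<in> {i, j}" "l \<in> {i, j}"
      using ij(1) by auto
    then show ?thesis
      using entries[OF assms(2)] entries[OF assms(3)] ij(2)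
      by (auto simp: matrix_matrix_mult_def sum_ij algebra_simps)
  qed
  then show ?thesis
    by (simp add: vec_eq_iff)
qed

section \<open>Moving patches and tilings\<close>

lemma move_compose: "move f (move g P) = move (f \<circ> g) P"
  by (simp add: move_def image_comp map_prod.comp) (simp add: o_def image_image)

lemma move_id: "move id P = P"
  by (simp add: move_def map_prod.id)

lemma move_motion: "move (motion A v) (move (motion B w) P) = move (motion (A ** B) (v + A *v w)) P"
  by (simp add: move_compose motion_comp)

lemma move_motion_inverse:
  assumes "rotation_matrix A"
  shows "move (motion A v) (move (motion (transpose A) (- (transpose A *v v))) P) = P"
    and "move (motion (transpose A) (- (transpose A *v v))) (move (motion A v) P) = P"
  by (simp_all add: move_compose motion_inverse[OF assms] move_id)

lemma move_mono: "P \<subseteq> Q \<Longrightarrow> move f P \<subseteq> move f Q"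
  by (auto simp: move_def)

lemma inj_move_tile: "inj f \<Longrightarrow> inj (map_prod ((`) f) id)"
  by (auto simp: inj_def inj_image_eq_iff)

lemma finite_move_iff: "inj f \<Longrightarrow> finite (move f P) \<longleftrightarrow> finite P"
  unfolding move_def by (meson finite_image_iff inj_move_tile inj_on_subset subset_UNIV)

lemma move_motion_subset_iff:
  assumes "rotation_matrix A"
  shows "move (motion A v) P \<subseteq> T \<longleftrightarrow> P \<subseteq> move (motion (transpose A) (- (transpose A *v v))) T"
  by (metis assms move_mono move_motion_inverse)

lemma patch_at_move:
  assumes "rotation_matrix A"
  shows "patch_at (move (motion A v) T) r (motion A v x) = move (motion A v) (patch_at T r x)"
proof -
  have "motion A v ` S \<inter> cball (motion A v x) r = {} \<longleftrightarrow> S \<inter> cball x r = {}" for S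
    by (auto simp: disjoint_iff dist_motion[OF assms])
  then show ?thesis
    unfolding patch_at_def move_def Compr_image_eq by simp
qed

lemma motion_image_eq: "motion A v ` S = (+) v ` ((*v) A ` S)"
  by (auto simp: motion_def)

lemma
  assumes "rotation_matrix A"
  shows interior_motion_image: "interior (motion A v ` S) = motion A v ` interior S"
    and closure_motion_image: "closure (motion A v ` S) = motion A v ` closure S"
    and polytope_motion_image: "polytope S \<Longrightarrow> polytope (motion A v ` S)"
proof -
  have lin: "linear ((*v) A)" and inj: "inj ((*v) A)"
    using orthogonal_transformation_rotation[OF assms]
    by (auto simp: orthogonal_transformation_linear orthogonal_transformation_inj)
  show "interior (motion A v ` S) = motion A v ` interior S"
    by (simp only: motion_image_eq interior_translation interior_injective_linear_image[OF lin inj])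
  show "closure (motion A v ` S) = motion A v ` closure S"
    by (simp only: motion_image_eq closure_translation closure_injective_linear_image[OF lin inj, symmetric])
  show "polytope (motion A v ` S)" if "polytope S"
    by (simp only: motion_image_eq polytope_translation_eq polytope_linear_image[OF lin that])
qed

lemma frontier_motion_image:
  assumes "rotation_matrix A"
  shows "frontier (motion A v ` S) = motion A v ` frontier S"
  by (simp add: frontier_def interior_motion_image closure_motion_image image_set_diff
      inj_motion assms)

lemma polyhedral_body_motion_image:
  assumes "rotation_matrix A" "polyhedral_body S"
  shows "polyhedral_body (motion A v ` S)"
proof -
  obtain F where F: "finite F" "F \<noteq> {}" "\<forall>C\<in>F. polytope C \<and> interior C \<noteq> {}" "S = \<Union>F"
    using assms(2) by (auto simp: polyhedral_body_def)
  then show ?thesis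
    unfolding polyhedral_body_def
    by (intro exI[of _ "(`) (motion A v) ` F"])
      (auto simp: interior_motion_image polytope_motion_image assms(1))
qed

lemma same_germ_motion_image:
  assumes "rotation_matrix A" "same_germ S x y"
  shows "same_germ (motion A v ` S) (motion A v x) (motion A v y)"
proof -
  obtain e where e: "e > 0" "\<And>u. u \<in> ball 0 e \<Longrightarrow> x + u \<in> S \<longleftrightarrow> y + u \<in> S"
    using assms(2) by (auto simp: same_germ_def)
  have "motion A v x + u \<in> motion A v ` S \<longleftrightarrow> motion A v y + u \<in> motion A v ` S"
    if "u \<in> ball 0 e" for u
  proof -
    let ?u = "transpose A *v u"
    have *: "motion A v z + u = motion A v (z + ?u)" for z
      by (simp add: motion_def matrix_vector_right_distrib matrix_vector_mul_assoc
          rotation_matrix_transpose_mult[OF assms(1)])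
    have "norm ?u = norm u"
      using orthogonal_transformation_rotation[OF rotation_matrix_transpose[OF assms(1)]]
      by (simp add: orthogonal_transformation)
    then have "x + ?u \<in> S \<longleftrightarrow> y + ?u \<in> S"
      using e(2) that by simp
    then show ?thesis
      by (simp add: * inj_image_mem_iff[OF inj_motion[OF assms(1)]])
  qed
  then show ?thesis
    using e(1) unfolding same_germ_def by blast
qed

lemma faces_motion_image:
  assumes A: "rotation_matrix A"
  shows "faces (motion A v ` S) = (`) (motion A v) ` faces S"
proof -
  let ?f = "motion A v"
  have germ: "same_germ (?f ` S) (?f x) (?f y) \<longleftrightarrow> same_germ S x y" for x y
  proof
    let ?g = "motion (transpose A) (- (transpose A *v v))"
    have gf: "?g ` ?f ` S = S" "?g (?f z) = z" for z
      using motion_inverse(2)[OF A, of v]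
      by (simp_all add: image_comp pointfree_idE)
    assume "same_germ (?f ` S) (?f x) (?f y)"
    from same_germ_motion_image[OF rotation_matrix_transpose[OF A] this, of "- (transpose A *v v)"]
    show "same_germ S x y"
      by (simp only: gf)
  qed (rule same_germ_motion_image[OF A])
  have "closure (connected_component_set {y \<in> ?f ` S. same_germ (?f ` S) (?f x) y} (?f x)) =
      ?f ` closure (connected_component_set {y \<in> S. same_germ S x y} x)" if x: "x \<in> S" for x
  proof -
    let ?Y = "{y \<in> S. same_germ S x y}"
    have im: "{y \<in> ?f ` S. same_germ (?f ` S) (?f x) y} = ?f ` ?Y"
      using germ by auto
    have "continuous_on UNIV (motion B w)" for B :: "real^'a^'a" and w
      unfolding motion_def by (intro continuous_intros matrix_vector_mult_linear_continuous_on)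
    then have "homeomorphism UNIV UNIV ?f (motion (transpose A) (- (transpose A *v v)))"
      using motion_inverse[OF A, of v] bij_motion[OF A] bij_motion[OF rotation_matrix_transpose[OF A]]
      unfolding homeomorphism_def bij_def by (simp add: fun_eq_iff)
    then obtain g where "homeomorphism ?Y (?f ` ?Y) ?f g"
      using homeomorphism_of_subsets[OF _ subset_UNIV subset_UNIV refl] by blast
    moreover have "x \<in> ?Y"
      using x by (auto simp: same_germ_def intro: exI[of _ 1])
    ultimately show ?thesis
      unfolding im by (simp only: connected_component_set_homeomorphism closure_motion_image[OF A])
  qed
  then show ?thesis
    unfolding faces_def Setcompr_eq_image image_image by (auto intro!: image_cong)
qed

lemma face_to_face_motion_image:
  assumes "rotation_matrix A" "face_to_face S S'"
  shows "face_to_face (motion A v ` S) (motion A v ` S')"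
proof -
  have "inj ((`) (motion A v))"
    using inj_motion[OF assms(1)] by (simp add: inj_def inj_image_eq_iff)
  then have "faces (motion A v ` S) \<inter> faces (motion A v ` S') =
      (`) (motion A v) ` (faces S \<inter> faces S')"
    by (simp add: faces_motion_image[OF assms(1)] image_Int)
  moreover have "motion A v ` S \<inter> motion A v ` S' = motion A v ` \<Union>(faces S \<inter> faces S')"
    using assms by (simp only: face_to_face_def image_Int[OF inj_motion, symmetric])
  ultimately show ?thesis
    by (simp add: face_to_face_def image_Union)
qed

lemma tiling_move:
  assumes A: "rotation_matrix A" and T: "tiling T"
  shows "tiling (move (motion A v) T)"
proof -
  let ?f = "motion A v"
  have inj: "inj ?f" and surj: "surj ?f"
    using bij_motion[OF A] by (auto simp: bij_def)
  obtain Q where Q: "finite Q" "\<And>t. t \<in> T \<Longrightarrow> \<exists>q\<in>Q. \<exists>v. t = ((+) v ` fst q, snd q)"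
    using T unfolding tiling_def by meson
  show ?thesis
    unfolding tiling_def
  proof (intro conjI ballI impI)
    show "polyhedral_body (fst t)" if "t \<in> move ?f T" for t
      using that T A by (auto simp: move_def tiling_def polyhedral_body_motion_image)
    have "(\<Union>t\<in>move ?f T. fst t) = ?f ` (\<Union>t\<in>T. fst t)"
      by (auto simp: move_def)
    then show "(\<Union>t\<in>move ?f T. fst t) = UNIV"
      using T surj by (simp add: tiling_def)
    fix s t assume st: "s \<in> move ?f T" "t \<in> move ?f T" "s \<noteq> t"
    obtain s' where s': "s' \<in> T" "s = map_prod ((`) ?f) id s'"
      using st(1) unfolding move_def by (rule imageE)
    obtain t' where t': "t' \<in> T" "t = map_prod ((`) ?f) id t'"
      using st(2) unfolding move_def by (rule imageE)
    have "s' \<noteq> t'"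
      using st(3) s'(2) t'(2) by blast
    have *: "fst s' \<inter> fst t' \<subseteq> frontier (fst s') \<inter> frontier (fst t')"
        "face_to_face (fst s') (fst t')"
      using T s'(1) t'(1) \<open>s' \<noteq> t'\<close> unfolding tiling_def by blast+
    show "fst s \<inter> fst t \<subseteq> frontier (fst s) \<inter> frontier (fst t)"
      using image_mono[OF *(1), of ?f] s'(2) t'(2)
      by (simp add: frontier_motion_image[OF A] image_Int[OF inj])
    show "face_to_face (fst s) (fst t)"
      using face_to_face_motion_image[OF A *(2)] s'(2) t'(2) by simp
  next
    show "\<exists>Q. finite Q \<and> (\<forall>t\<in>move ?f T. \<exists>q\<in>Q. \<exists>v. t = ((+) v ` fst q, snd q))"
    proof (intro exI conjI ballI)
      show "finite (move ((*v) A) Q)"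
        using Q(1) by (simp add: move_def)
      fix t assume "t \<in> move ?f T"
      then obtain t' where t': "t' \<in> T" "t = map_prod ((`) ?f) id t'"
        by (auto simp: move_def)
      obtain q w where q: "q \<in> Q" "t' = ((+) w ` fst q, snd q)"
        using Q(2)[OF t'(1)] by blast
      have "?f \<circ> (+) w = (+) (v + A *v w) \<circ> (*v) A"
        by (simp add: motion_def fun_eq_iff matrix_vector_right_distrib)
      then have "t = ((+) (v + A *v w) ` fst (map_prod ((`) ((*v) A)) id q),
          snd (map_prod ((`) ((*v) A)) id q))"
        using t'(2) q(2) by (simp add: image_comp)
      then show "\<exists>q\<in>move ((*v) A) Q. \<exists>v. t = ((+) v ` fst q, snd q)"
        using q(1) unfolding move_def by blast
    qed
  qed
qed

section \<open>Polyhedral bodies\<close>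

lemma polyhedral_body_compact: "polyhedral_body S \<Longrightarrow> compact S"
  unfolding polyhedral_body_def using polytope_imp_compact by blast

lemma polyhedral_body_interior_nonempty: "polyhedral_body S \<Longrightarrow> interior S \<noteq> {}"
  unfolding polyhedral_body_def using interior_mono by (metis Union_upper equals0I subset_empty)

lemma polyhedral_body_subset_closure_interior:
  assumes "polyhedral_body S"
  shows "S \<subseteq> closure (interior S)"
proof
  obtain F where F: "\<forall>C\<in>F. polytope C \<and> interior C \<noteq> {}" "S = \<Union>F"
    using assms by (auto simp: polyhedral_body_def)
  fix x assume "x \<in> S"
  then obtain C where C: "C \<in> F" "x \<in> C"
    using F(2) by blast
  then have "closure (interior C) = closure C"
    using F(1) by (simp add: convex_closure_interior polytope_imp_convex)
  then have "x \<in> closure (interior C)"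
    using C(2) closure_subset by blast
  moreover have "interior C \<subseteq> interior S"
    unfolding F(2) by (rule interior_mono) (use C(1) in blast)
  ultimately show "x \<in> closure (interior S)"
    using closure_mono by blast
qed

lemma extreme_point_of_motion:
  assumes A: "rotation_matrix A" and x: "x extreme_point_of (convex hull S)"
  shows "motion A v x extreme_point_of (convex hull (motion A v ` S))"
proof -
  have lin: "linear ((*v) A)" and inj: "inj ((*v) A)"
    using orthogonal_transformation_rotation[OF A]
    by (auto simp: orthogonal_transformation_linear orthogonal_transformation_inj)
  have hull: "convex hull (motion A v ` S) = motion A v ` (convex hull S)"
    by (simp only: motion_image_eq convex_hull_translation convex_hull_linear_image[OF lin])
  have seg: "open_segment (motion A v a) (motion A v b) = motion A v ` open_segment a b" for a b
    unfolding motion_image_eq motion_def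
    by (simp only: open_segment_translation open_segment_linear_image[OF lin inj])
  show ?thesis
    using x unfolding hull extreme_point_of_def
    by (auto simp: seg inj_image_mem_iff[OF inj_motion[OF A]])
qed

lemma finite_extreme_points_polyhedral_body:
  assumes "polyhedral_body S"
  shows "finite {x. x extreme_point_of (convex hull S)}"
proof -
  obtain F where F: "finite F" "\<forall>C\<in>F. polytope C" "S = \<Union>F"
    using assms by (auto simp: polyhedral_body_def)
  then obtain V where V: "\<And>C. C \<in> F \<Longrightarrow> finite (V C) \<and> C = convex hull (V C)"
    unfolding polytope_def by metis
  have "convex hull S = convex hull (\<Union>C\<in>F. V C)"
  proof
    have "C \<subseteq> convex hull (\<Union>C\<in>F. V C)" if "C \<in> F" for C
      using V[OF that] that by (metis UN_upper hull_mono)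
    then show "convex hull S \<subseteq> convex hull (\<Union>C\<in>F. V C)"
      unfolding F(3) by (intro hull_minimal) auto
    have "V C \<subseteq> S" if "C \<in> F" for C
      using V[OF that] that F(3) by (metis Union_upper hull_subset order_trans)
    then show "convex hull (\<Union>C\<in>F. V C) \<subseteq> convex hull S"
      by (intro hull_mono) blast
  qed
  then have "{x. x extreme_point_of (convex hull S)} \<subseteq> (\<Union>C\<in>F. V C)"
    using extreme_point_of_convex_hull by auto
  then show ?thesis
    using finite_subset F(1) V by blast
qed

text \<open>A rotation that carries one polyhedral body onto a translate of another carries the vertices
  of the first convex hull to those of the second, and so their finitely many differences to
  such differences. It is determined by its values on them, because they span the space.\<close>

proposition finite_rotations_between_polyhedral_bodies:
  fixes S S' :: "(real^'n) set"
  assumes S: "polyhedral_body S" and S': "polyhedral_body S'"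
  shows "finite {A. rotation_matrix A \<and> (\<exists>v. motion A v ` S = S')}" (is "finite ?M")
proof -
  define E where "E X = {x. x extreme_point_of (convex hull X)}" for X :: "(real^'n) set"
  define D where "D X = (\<lambda>(x, y). x - y) ` (E X \<times> E X)" for X
  have fin: "finite (D S)" "finite (D S')"
    using finite_extreme_points_polyhedral_body S S' by (auto simp: D_def E_def)
  have maps: "A *v d \<in> D S'" if "A \<in> ?M" "d \<in> D S" for A d
  proof -
    obtain v where A: "rotation_matrix A" "motion A v ` S = S'"
      using \<open>A \<in> ?M\<close> by blast
    obtain x y where xy: "x \<in> E S" "y \<in> E S" "d = x - y"
      using \<open>d \<in> D S\<close> by (auto simp: D_def)
    have "motion A v x \<in> E S'" "motion A v y \<in> E S'"
      using extreme_point_of_motion[OF A(1)] xy(1,2) A(2) unfolding E_def by blast+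
    moreover have "A *v d = motion A v x - motion A v y"
      by (simp add: xy(3) motion_def matrix_vector_mult_diff_distrib)
    ultimately show ?thesis
      by (auto simp: D_def)
  qed
  have span: "span (D S) = UNIV"
  proof -
    have "compact (convex hull S)"
      using S by (simp add: compact_convex_hull polyhedral_body_compact)
    then have hull: "convex hull (E S) = convex hull S"
      unfolding E_def using Krein_Milman_Minkowski convex_convex_hull by blast
    have "interior S \<subseteq> interior (convex hull S)"
      by (simp add: hull_subset interior_mono)
    then have ne: "interior (convex hull E S) \<noteq> {}"
      using polyhedral_body_interior_nonempty[OF S] hull by auto
    then have aff: "affine hull (E S) = UNIV"
      using affine_hull_nonempty_interior[OF ne] by simp
    then obtain a where a: "a \<in> E S"
      by (metis UNIV_not_empty affine_hull_empty equals0I)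
    have "E S \<subseteq> (+) a ` span (D S)"
    proof
      fix x assume "x \<in> E S"
      then have "x - a \<in> span (D S)"
        using a by (intro span_base) (auto simp: D_def)
      then show "x \<in> (+) a ` span (D S)"
        by (intro image_eqI[of _ _ "x - a"]) auto
    qed
    moreover have "affine ((+) a ` span (D S))"
      using affine_translation[of "span (D S)" a] by (simp add: subspace_imp_affine)
    ultimately have "(+) a ` span (D S) = UNIV"
      using aff hull_minimal by (metis top.extremum_uniqueI)
    then show ?thesis
      by (metis add_left_imp_eq image_iff UNIV_I UNIV_eq_I)
  qed
  have "inj_on (\<lambda>A. restrict ((*v) A) (D S)) ?M"
  proof (rule inj_onI)
    fix A B assume "restrict ((*v) A) (D S) = restrict ((*v) B) (D S)"
    then have "A *v d = B *v d" if "d \<in> D S" for d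
      using that by (metis restrict_apply')
    then have "A *v x = B *v x" for x
      using linear_eq_on_span[of "(*v) A" "(*v) B" "D S" x] span by simp
    then show "A = B"
      by (simp add: matrix_eq)
  qed
  moreover have "(\<lambda>A. restrict ((*v) A) (D S)) ` ?M \<subseteq> (\<Pi>\<^sub>E d\<in>D S. D S')"
  proof (intro image_subsetI PiE_I)
    fix A d assume "A \<in> ?M" "d \<in> D S"
    then show "restrict ((*v) A) (D S) d \<in> D S'"
      using maps by simp
  qed simp
  ultimately show ?thesis
    using fin by (metis (no_types, lifting) finite_PiE inj_on_finite)
qed

section \<open>Local structure of tilings\<close>

lemma tiling_polyhedral_body: "tiling T \<Longrightarrow> t \<in> T \<Longrightarrow> polyhedral_body (fst t)"
  by (simp add: tiling_def)

lemma tiling_covers: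
  assumes "tiling T"
  obtains t where "t \<in> T" "x \<in> fst t"
proof -
  have "x \<in> (\<Union>t\<in>T. fst t)"
    using assms by (simp add: tiling_def)
  then show ?thesis
    using that by blast
qed

lemma tiling_interior_disjoint:
  assumes "tiling T" "s \<in> T" "t \<in> T" "x \<in> interior (fst s)" "x \<in> fst t"
  shows "s = t"
proof (rule ccontr)
  assume "s \<noteq> t"
  then have "fst s \<inter> fst t \<subseteq> frontier (fst s)"
    using assms(1-3) unfolding tiling_def by blast
  then show False
    using assms(4,5) interior_subset by (auto simp: frontier_def)
qed

text \<open>The prototiles can be chosen among the tiles.\<close>

lemma tiling_prototiles:
  assumes "tiling T"
  obtains Q where "finite Q" "Q \<subseteq> T"
    "\<And>t. t \<in> T \<Longrightarrow> \<exists>q\<in>Q. \<exists>v. t = map_prod ((`) (motion (mat 1) v)) id q"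
proof -
  obtain Q where Q: "finite Q" "\<And>t. t \<in> T \<Longrightarrow> \<exists>q\<in>Q. \<exists>v. t = ((+) v ` fst q, snd q)"
    using assms unfolding tiling_def by meson
  define c where "c q = (SOME t. t \<in> T \<and> (\<exists>v. t = ((+) v ` fst q, snd q)))" for q
  let ?Q = "c ` {q \<in> Q. \<exists>t\<in>T. \<exists>v. t = ((+) v ` fst q, snd q)}"
  have c: "c q \<in> T \<and> (\<exists>v. c q = ((+) v ` fst q, snd q))"
    if "t \<in> T" "t = ((+) v ` fst q, snd q)" for q t v
    unfolding c_def by (rule someI[of _ t]) (use that in blast)
  have repr: "\<exists>q\<in>?Q. \<exists>v. t = map_prod ((`) (motion (mat 1) v)) id q" if t: "t \<in> T" for t
  proof -
    obtain q v where q: "q \<in> Q" "t = ((+) v ` fst q, snd q)"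
      using Q(2)[OF t] by blast
    obtain w where w: "c q = ((+) w ` fst q, snd q)"
      using c[OF t q(2)] by blast
    have "t = map_prod ((`) (motion (mat 1) (v - w))) id (c q)"
      by (simp add: w q(2) translation_eq_motion[symmetric] image_image)
    then show ?thesis
      using q t by blast
  qed
  have sub: "?Q \<subseteq> T"
  proof
    fix x assume "x \<in> ?Q"
    then obtain q t v where "x = c q" "t \<in> T" "t = ((+) v ` fst q, snd q)"
      by blast
    then show "x \<in> T"
      using c by blast
  qed
  show thesis
    by (rule that[OF _ sub repr]) (use Q(1) in auto)
qed

lemma tiling_tile_size:
  assumes "tiling T"
  obtains e D where "e > 0" "\<And>t. t \<in> T \<Longrightarrow> \<exists>c. ball c e \<subseteq> fst t \<and> fst t \<subseteq> cball c D"
proof -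
  obtain Q where Q: "finite Q" "Q \<subseteq> T"
    "\<And>t. t \<in> T \<Longrightarrow> \<exists>q\<in>Q. \<exists>v. t = map_prod ((`) (motion (mat 1) v)) id q"
    using tiling_prototiles[OF assms] by blast
  have "\<exists>e D c. e > 0 \<and> ball c e \<subseteq> fst q \<and> fst q \<subseteq> cball c D" if "q \<in> Q" for q
  proof -
    have body: "polyhedral_body (fst q)"
      using assms Q(2) that tiling_polyhedral_body by blast
    then obtain c e where "e > 0" "ball c e \<subseteq> fst q"
      using polyhedral_body_interior_nonempty mem_interior by blast
    moreover have "\<exists>D. fst q \<subseteq> cball c D"
      using compact_imp_bounded[OF polyhedral_body_compact[OF body]]
      by (metis bounded_any_center mem_cball subsetI)
    ultimately show ?thesis
      by blast
  qed
  then obtain e D c where edc: "\<And>q. q \<in> Q \<Longrightarrow> e q > 0 \<and> ball (c q) (e q) \<subseteq> fst q \<and> fst q \<subseteq> cball (c q) (D q)"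
    by metis
  define e' D' where "e' = Min (insert 1 (e ` Q))" and "D' = Max (insert 0 (D ` Q))"
  have size: "ball (c q) e' \<subseteq> fst q" "fst q \<subseteq> cball (c q) D'" if "q \<in> Q" for q
  proof -
    have "e' \<le> e q" "D q \<le> D'"
      using Q(1) that by (auto simp: e'_def D'_def)
    then show "ball (c q) e' \<subseteq> fst q" "fst q \<subseteq> cball (c q) D'"
      using edc[OF that] subset_ball[of e' "e q" "c q"] subset_cball[of "D q" D' "c q"] by auto
  qed
  show thesis
  proof
    show "0 < e'"
      using Q(1) edc by (simp add: e'_def)
    fix t assume "t \<in> T"
    then obtain q v where q: "q \<in> Q" "t = map_prod ((`) (motion (mat 1) v)) id q"
      using Q(3) by blast
    then have t: "fst t = (+) v ` fst q"
      by (simp add: translation_eq_motion)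
    have "ball (v + c q) e' \<subseteq> fst t" "fst t \<subseteq> cball (v + c q) D'"
      unfolding t ball_translation cball_translation
      by (intro image_mono size q(1))+
    then show "\<exists>c. ball c e' \<subseteq> fst t \<and> fst t \<subseteq> cball c D'"
      by blast
  qed
qed

text \<open>Every tile contains a ball of a fixed radius, so that the centres of these balls are
  separated; only finitely many of them lie in a bounded region.\<close>

lemma finite_patch_at:
  assumes T: "tiling T"
  shows "finite (patch_at T r x)"
proof (rule ccontr)
  assume inf: "infinite (patch_at T r x)"
  obtain e D where eD: "e > 0" "\<And>t. t \<in> T \<Longrightarrow> \<exists>c. ball c e \<subseteq> fst t \<and> fst t \<subseteq> cball c D"
    using tiling_tile_size[OF T] by blast
  then obtain c where c: "\<And>t. t \<in> T \<Longrightarrow> ball (c t) e \<subseteq> fst t \<and> fst t \<subseteq> cball (c t) D"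
    by metis
  have sep: "s = t" if "s \<in> T" "t \<in> T" "dist (c s) (c t) < e" for s t
  proof (rule tiling_interior_disjoint[OF T that(1,2)])
    have "ball (c s) e \<subseteq> interior (fst s)"
      using c[OF that(1)] by (simp add: interior_maximal)
    then show "c t \<in> interior (fst s)"
      using that(3) by auto
    show "c t \<in> fst t"
      using c[OF that(2)] eD(1) by auto
  qed
  have sub: "patch_at T r x \<subseteq> T"
    by (auto simp: patch_at_def)
  have "inj_on c (patch_at T r x)"
    using sep sub eD(1) by (metis dist_self inj_onI subsetD)
  then have infc: "infinite (c ` patch_at T r x)"
    using inf finite_imageD by blast
  have "c ` patch_at T r x \<subseteq> cball x (r + D)"
  proof clarify
    fix a b assume t: "(a, b) \<in> patch_at T r x"
    then obtain y where "y \<in> a" "dist x y \<le> r"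
      by (auto simp: patch_at_def)
    moreover have "dist (c (a, b)) y \<le> D"
      using c[of "(a, b)"] sub t \<open>y \<in> a\<close> by fastforce
    ultimately show "c (a, b) \<in> cball x (r + D)"
      using dist_triangle[of x "c (a, b)" y] by (simp add: dist_commute)
  qed
  then have "bounded (c ` patch_at T r x)"
    using bounded_cball bounded_subset by blast
  then obtain z where "z islimpt (c ` patch_at T r x)"
    using bounded_infinite_imp_islimpt infc by blast
  then have "infinite (c ` patch_at T r x \<inter> ball z (e / 2))" (is "infinite ?C")
    using eD(1) by (simp add: islimpt_eq_infinite_ball)
  then obtain p where p: "p \<in> ?C"
    using infinite_imp_nonempty by blast
  from \<open>infinite ?C\<close> have "infinite (?C - {p})"
    by simp
  then have "\<exists>q. q \<in> ?C - {p}"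
    unfolding ex_in_conv by (rule infinite_imp_nonempty)
  then obtain q where "q \<in> ?C - {p}"
    by (rule exE)
  with p have pq: "p \<in> c ` patch_at T r x" "q \<in> c ` patch_at T r x" "p \<noteq> q"
      "dist z p < e / 2" "dist z q < e / 2"
    by auto
  then have "dist p q < e"
    using dist_triangle_half_r by blast
  then show False
    using pq(1-3) sep sub by blast
qed

text \<open>The \<open>r\<close>-patch at a point covers a neighbourhood of the ball, since the finitely many other
  tiles nearby are closed. A tiling that contains this patch can therefore have no further tile
  meeting the ball: the interior of such a tile would overlap the patch.\<close>

lemma patch_at_eqI:
  assumes U: "tiling U" and T: "tiling T" and sub: "patch_at U r x \<subseteq> T"
  shows "patch_at T r x = patch_at U r x"
proof
  show "patch_at U r x \<subseteq> patch_at T r x"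
    using sub by (auto simp: patch_at_def)
  show "patch_at T r x \<subseteq> patch_at U r x"
  proof
    fix t assume "t \<in> patch_at T r x"
    then obtain y where t: "t \<in> T" and y: "y \<in> fst t" "dist x y \<le> r"
      by (auto simp: patch_at_def)
    define K where "K = (\<Union>p\<in>patch_at U (r + 1) x - patch_at U r x. fst p)"
    have "closed K"
      unfolding K_def
    proof (intro closed_UN ballI)
      show "finite (patch_at U (r + 1) x - patch_at U r x)"
        using finite_patch_at[OF U] by blast
      fix p assume "p \<in> patch_at U (r + 1) x - patch_at U r x"
      then have "p \<in> U"
        by (simp add: patch_at_def)
      then show "closed (fst p)"
        by (intro compact_imp_closed polyhedral_body_compact tiling_polyhedral_body[OF U])
    qed
    moreover have "y \<notin> K"
      using y(2) by (auto simp: K_def patch_at_def)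
    moreover have "y \<in> closure (interior (fst t))"
      using polyhedral_body_subset_closure_interior[OF tiling_polyhedral_body[OF T t]] y(1) by blast
    ultimately have "(ball y 1 - K) \<inter> interior (fst t) \<noteq> {}"
      using open_Int_closure_eq_empty[OF open_Diff[OF open_ball \<open>closed K\<close>], of y 1 "interior (fst t)"]
      by (metis Diff_iff IntI centre_in_ball empty_iff zero_less_one)
    then obtain z where z: "z \<in> interior (fst t)" "z \<in> ball y 1 - K"
      by blast
    obtain p where p: "p \<in> U" "z \<in> fst p"
      using tiling_covers[OF U] .
    have "dist x z \<le> r + 1"
      using dist_triangle[of x z y] y(2) z(2) by simp
    then have "p \<in> patch_at U (r + 1) x"
      using p by (auto simp: patch_at_def)
    then have "p \<in> patch_at U r x"
      using p(2) z(2) by (auto simp: K_def)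
    moreover have "t = p"
      using tiling_interior_disjoint[OF T t _ z(1) p(2)] sub calculation by blast
    ultimately show "t \<in> patch_at U r x"
      by simp
  qed
qed

lemma finite_subset_patch_at:
  assumes "tiling T" "finite P" "P \<subseteq> T"
  obtains r where "r > 0" "P \<subseteq> patch_at T r x" "\<And>t. t \<in> P \<Longrightarrow> fst t \<subseteq> cball x r"
proof -
  have "\<exists>r. fst t \<subseteq> cball x r" if "t \<in> P" for t
    using compact_imp_bounded[OF polyhedral_body_compact[OF tiling_polyhedral_body[OF assms(1)]]] that assms(3)
    by (metis bounded_any_center mem_cball subsetI subsetD)
  then obtain r where r: "\<And>t. t \<in> P \<Longrightarrow> fst t \<subseteq> cball x (r t)"
    by metis
  let ?r = "Max (insert 1 (r ` P))"
  have le: "fst t \<subseteq> cball x ?r" if "t \<in> P" for t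
    using r[OF that] subset_cball[of "r t" ?r x] assms(2) that by auto
  show thesis
  proof
    show "?r > 0"
      using assms(2) by (simp add: Max_gr_iff)
    show "P \<subseteq> patch_at T ?r x"
    proof
      fix t assume t: "t \<in> P"
      then have "fst t \<noteq> {}"
        using polyhedral_body_interior_nonempty tiling_polyhedral_body assms(1,3) interior_subset by blast
      then show "t \<in> patch_at T ?r x"
        using le[OF t] t assms(3) by (auto simp: patch_at_def)
    qed
  qed (rule le)
qed

proposition finite_rotations_between_tilings:
  assumes T: "tiling T" and T': "tiling T'"
  shows "finite {A. rotation_matrix A \<and> (\<exists>s\<in>T. \<exists>t\<in>T'. \<exists>v. motion A v ` fst s = fst t)}"
    (is "finite ?M")
proof -
  obtain Q where Q: "finite Q" "Q \<subseteq> T"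
    "\<And>t. t \<in> T \<Longrightarrow> \<exists>q\<in>Q. \<exists>v. t = map_prod ((`) (motion (mat 1) v)) id q"
    using tiling_prototiles[OF T] by blast
  obtain Q' where Q': "finite Q'" "Q' \<subseteq> T'"
    "\<And>t. t \<in> T' \<Longrightarrow> \<exists>q\<in>Q'. \<exists>v. t = map_prod ((`) (motion (mat 1) v)) id q"
    using tiling_prototiles[OF T'] by blast
  have "?M \<subseteq> (\<Union>q\<in>Q. \<Union>q'\<in>Q'. {A. rotation_matrix A \<and> (\<exists>v. motion A v ` fst q = fst q')})"
  proof
    fix A assume "A \<in> ?M"
    then obtain s t v where A: "rotation_matrix A" and st: "s \<in> T" "t \<in> T'" "motion A v ` fst s = fst t"
      by blast
    obtain q u where q: "q \<in> Q" "s = map_prod ((`) (motion (mat 1) u)) id q"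
      using Q(3)[OF st(1)] by blast
    obtain q' w where q': "q' \<in> Q'" "t = map_prod ((`) (motion (mat 1) w)) id q'"
      using Q'(3)[OF st(2)] by blast
    have "motion (mat 1) (- w) ` motion A v ` motion (mat 1) u ` fst q =
        motion (mat 1) (- w) ` motion (mat 1) w ` fst q'"
      using st(3) q(2) q'(2) by simp
    then have "motion A (- w + (v + A *v u)) ` fst q = fst q'"
      by (simp add: image_comp motion_comp motion_mat_1_0)
    then show "A \<in> (\<Union>q\<in>Q. \<Union>q'\<in>Q'. {A. rotation_matrix A \<and> (\<exists>v. motion A v ` fst q = fst q')})"
      using q(1) q'(1) A by blast
  qed
  moreover have "finite (\<Union>q\<in>Q. \<Union>q'\<in>Q'. {A. rotation_matrix A \<and> (\<exists>v. motion A v ` fst q = fst q')})"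
    using Q(1,2) Q'(1,2) T T'
    by (intro finite_UN_I finite_rotations_between_polyhedral_bodies) (auto intro: tiling_polyhedral_body)
  ultimately show ?thesis
    by (rule finite_subset)
qed

section \<open>Patches that fit into a tiling\<close>

text \<open>The patch \<open>P\<close>, rotated by \<open>A\<close>, is contained in \<open>T\<close> up to translation.\<close>

definition fits :: "('n::finite, 'l) tiling \<Rightarrow> real^'n^'n \<Rightarrow> ('n, 'l) tile set \<Rightarrow> bool" where
  "fits T A P \<longleftrightarrow> (\<exists>v. move (motion A v) P \<subseteq> T)"

lemma fits_mono: "fits T A P \<Longrightarrow> P' \<subseteq> P \<Longrightarrow> fits T A P'"
  unfolding fits_def using move_mono by blast

lemma fits_subset: "P \<subseteq> T \<Longrightarrow> fits T (mat 1) P"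
  unfolding fits_def by (rule exI[of _ 0]) (simp add: motion_mat_1_0 move_id)

lemma fits_move:
  "fits T A (move (motion B w) P) \<longleftrightarrow> fits T (A ** B) P"
proof
  show "fits T A (move (motion B w) P) \<Longrightarrow> fits T (A ** B) P"
    unfolding fits_def move_motion by blast
  assume "fits T (A ** B) P"
  then obtain v where "move (motion (A ** B) v) P \<subseteq> T"
    unfolding fits_def by blast
  then show "fits T A (move (motion B w) P)"
    unfolding fits_def move_motion by (intro exI[of _ "v - A *v w"]) simp
qed

lemma fits_move_tiling:
  assumes "rotation_matrix B"
  shows "fits (move (motion B w) T) A P \<longleftrightarrow> fits T (transpose B ** A) P"
proof
  assume "fits T (transpose B ** A) P"
  then obtain v where "move (motion (transpose B ** A) v) P \<subseteq> T"
    unfolding fits_def by blast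
  from move_mono[OF this, of "motion B w"]
  have "move (motion (B ** (transpose B ** A)) (w + B *v v)) P \<subseteq> move (motion B w) T"
    by (simp only: move_motion)
  then show "fits (move (motion B w) T) A P"
    unfolding fits_def matrix_mul_assoc rotation_matrix_transpose_mult(2)[OF assms] matrix_mul_lid by blast
next
  assume "fits (move (motion B w) T) A P"
  then obtain v where "move (motion A v) P \<subseteq> move (motion B w) T"
    unfolding fits_def by blast
  from move_mono[OF this, of "motion (transpose B) (- (transpose B *v w))"]
  have "move (motion (transpose B) (- (transpose B *v w))) (move (motion A v) P) \<subseteq> T"
    by (simp only: move_motion_inverse(2)[OF assms])
  then show "fits T (transpose B ** A) P"
    unfolding fits_def move_motion by blast
qed

lemma appears_rotate_iff:
  assumes "rotation_matrix A"
  shows "appears_up_to_translation T (rotate A P) \<longleftrightarrow> finite P \<and> fits T A P"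
proof -
  have "translate v (rotate A P) = move (motion A v) P" for v
  proof -
    have "translate v (rotate A P) = move (motion (mat 1) v) (move (motion A 0) P)"
      by (simp only: translation_eq_motion rotation_eq_motion[symmetric])
    then show ?thesis
      by (simp add: move_motion)
  qed
  then show ?thesis
    by (auto simp: appears_up_to_translation_def patch_def fits_def
        finite_move_iff[OF inj_motion[OF assms]])
qed

lemma appears_iff: "appears_up_to_translation T P \<longleftrightarrow> finite P \<and> fits T (mat 1) P"
  using appears_rotate_iff[OF rotation_matrix_mat_1, of T P]
  by (simp add: rotation_eq_motion motion_mat_1_0 move_id)

lemma finite_rotations_fits:
  assumes S: "tiling S" and T: "tiling T"
  shows "finite {A. rotation_matrix A \<and> (\<exists>x. fits T A (patch_at S 0 x))}" (is "finite ?H")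
proof -
  let ?M = "{A. rotation_matrix A \<and> (\<exists>s\<in>S. \<exists>t\<in>T. \<exists>v. motion A v ` fst s = fst t)}"
  have "?H \<subseteq> ?M"
  proof
    fix A assume "A \<in> ?H"
    then obtain x v where A: "rotation_matrix A" "move (motion A v) (patch_at S 0 x) \<subseteq> T"
      unfolding fits_def by blast
    obtain s where s: "s \<in> S" "x \<in> fst s"
      using tiling_covers[OF S] .
    then have "s \<in> patch_at S 0 x"
      by (auto simp: patch_at_def)
    then have "map_prod ((`) (motion A v)) id s \<in> move (motion A v) (patch_at S 0 x)"
      unfolding move_def by (rule imageI)
    then have t: "map_prod ((`) (motion A v)) id s \<in> T"
      using A(2) by (rule rev_subsetD)
    have "motion A v ` fst s = fst (map_prod ((`) (motion A v)) id s)"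
      by simp
    then show "A \<in> ?M"
      using A(1) s(1) t by blast
  qed
  then show ?thesis
    using finite_rotations_between_tilings[OF S T] by (rule finite_subset)
qed

lemma Omega_t_iff:
  "S \<in> Omega_t T \<longleftrightarrow> tiling S \<and> (\<forall>P. finite P \<longrightarrow> P \<subseteq> S \<longrightarrow> fits T (mat 1) P)"
  by (auto simp: Omega_t_def patch_def appears_iff)

lemma Omega_t_self: "tiling T \<Longrightarrow> T \<in> Omega_t T"
  by (simp add: Omega_t_iff fits_subset)

lemma Omega_t_translate:
  assumes "S \<in> Omega_t T"
  shows "translate w S \<in> Omega_t T"
  unfolding Omega_t_iff
proof (intro conjI allI impI)
  show "tiling (translate w S)"
    using assms by (simp add: Omega_t_iff translation_eq_motion tiling_move rotation_matrix_mat_1)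
  fix P assume P: "finite P" "P \<subseteq> translate w S"
  let ?P = "move (motion (mat 1) (- w)) P"
  have "?P \<subseteq> S"
    using P(2) move_motion_subset_iff[OF rotation_matrix_mat_1, of "- w" P S]
    by (simp add: translation_eq_motion transpose_mat)
  moreover have "finite ?P"
    using P(1) by (simp add: move_def)
  ultimately have "fits T (mat 1) ?P"
    using assms by (simp add: Omega_t_iff)
  then show "fits T (mat 1) P"
    by (simp add: fits_move)
qed

section \<open>Repetitivity and minimality\<close>

lemma tiling_tile_nonempty: "tiling T \<Longrightarrow> t \<in> T \<Longrightarrow> fst t \<noteq> {}"
  using tiling_polyhedral_body polyhedral_body_interior_nonempty by fastforce

lemma repetitive_fits_patch:
  assumes T: "tiling T" and rep: "repetitive T" and r: "r > 0"
  obtains R where "\<And>y. fits (patch_at T R y) (mat 1) (patch_at T r x)"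
proof -
  have "r_patch T r (patch_at T r x)"
    by (auto simp: r_patch_def)
  then obtain R where R: "\<And>y. \<exists>v. patch T (translate v (patch_at T r x)) \<and>
      (\<forall>t\<in>translate v (patch_at T r x). fst t \<subseteq> cball y R)"
    using rep r unfolding repetitive_def by meson
  have "fits (patch_at T R y) (mat 1) (patch_at T r x)" for y
  proof -
    obtain v where v: "translate v (patch_at T r x) \<subseteq> T"
        "\<And>t. t \<in> translate v (patch_at T r x) \<Longrightarrow> fst t \<subseteq> cball y R"
      using R[of y] unfolding patch_def by metis
    have "translate v (patch_at T r x) \<subseteq> patch_at T R y"
    proof
      fix t assume t: "t \<in> translate v (patch_at T r x)"
      have "t \<in> T" "fst t \<subseteq> cball y R"
        using v(1) t by (rule subsetD) (rule v(2)[OF t])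
      then show "t \<in> patch_at T R y"
        using tiling_tile_nonempty[OF T \<open>t \<in> T\<close>] by (auto simp: patch_at_def)
    qed
    then show ?thesis
      unfolding fits_def translation_eq_motion by blast
  qed
  then show thesis
    by (rule that)
qed

text \<open>A large patch of \<open>S\<close> around the origin is also the patch of \<open>T\<close> on some ball, and by
  repetitivity this ball contains a copy of \<open>P\<close>.\<close>

lemma repetitive_imp_fits:
  assumes T: "tiling T" and rep: "repetitive T" and S: "S \<in> Omega_t T"
    and P: "finite P" "P \<subseteq> T"
  shows "fits S (mat 1) P"
proof -
  obtain r where r: "r > 0" "P \<subseteq> patch_at T r 0" "\<And>t. t \<in> P \<Longrightarrow> fst t \<subseteq> cball 0 r"
    using finite_subset_patch_at[OF T P] by metis
  let ?P = "patch_at T r 0"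
  obtain R where R: "\<And>y. fits (patch_at T R y) (mat 1) ?P"
    using repetitive_fits_patch[OF T rep r(1)] by blast
  have tS: "tiling S"
    using S by (simp add: Omega_t_iff)
  have "fits T (mat 1) (patch_at S R 0)"
    using S finite_patch_at[OF tS] by (auto simp: Omega_t_iff patch_at_def)
  then obtain w where w: "move (motion (mat 1) w) (patch_at S R 0) \<subseteq> T"
    unfolding fits_def by blast
  let ?S = "move (motion (mat 1) w) S"
  have *: "move (motion (mat 1) w) (patch_at S R 0) = patch_at ?S R w"
    using patch_at_move[OF rotation_matrix_mat_1, of w S R 0] by (simp add: motion_def)
  have eq: "patch_at T R w = patch_at ?S R w"
    using patch_at_eqI[OF tiling_move[OF rotation_matrix_mat_1 tS] T] w unfolding * by blast
  obtain v where "move (motion (mat 1) v) ?P \<subseteq> patch_at T R w"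
    using R[of w] unfolding fits_def by blast
  also have "\<dots> \<subseteq> ?S"
    unfolding eq by (auto simp: patch_at_def)
  finally have "fits ?S (mat 1) ?P"
    unfolding fits_def by blast
  then have "fits S (mat 1) ?P"
    by (simp add: fits_move_tiling rotation_matrix_mat_1 transpose_mat)
  then show ?thesis
    using r(2) fits_mono by blast
qed

lemma topspace_tiling_topology: "topspace (tiling_topology X) = X"
proof -
  have "openin (tiling_topology X) X"
    unfolding openin_tiling_topology by (auto intro: exI[of _ 1])
  then show ?thesis
    by (metis openin_subset openin_tiling_topology openin_topspace subset_antisym)
qed

lemma repetitive_imp_minimal:
  assumes T: "tiling T" and rep: "repetitive T"
  shows "minimal_system (Omega_t T)"
  unfolding minimal_system_def
proof (intro ballI subset_antisym)
  fix S assume S: "S \<in> Omega_t T"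
  show "tiling_topology (Omega_t T) closure_of range (\<lambda>v. translate v S) \<subseteq> Omega_t T"
    using closure_of_subset_topspace[of "tiling_topology (Omega_t T)"]
    by (simp only: topspace_tiling_topology)
  show "Omega_t T \<subseteq> tiling_topology (Omega_t T) closure_of range (\<lambda>v. translate v S)"
  proof
    fix U assume U: "U \<in> Omega_t T"
    then have tU: "tiling U"
      by (simp add: Omega_t_iff)
    have "\<exists>y. y \<in> range (\<lambda>v. translate v S) \<and> y \<in> V"
      if V: "U \<in> V" "openin (tiling_topology (Omega_t T)) V" for V
    proof -
      obtain e where e: "e > 0" "\<And>S'. S' \<in> Omega_t T \<Longrightarrow> close_tilings e U S' \<Longrightarrow> S' \<in> V"
        using V unfolding openin_tiling_topology by meson
      let ?P = "patch_at U (1 / e) 0"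
      have P: "finite ?P" "?P \<subseteq> U"
        using finite_patch_at[OF tU] by (auto simp: patch_at_def)
      then have "fits T (mat 1) ?P"
        using U by (simp add: Omega_t_iff)
      then obtain v where "move (motion (mat 1) v) ?P \<subseteq> T"
        unfolding fits_def by blast
      moreover have "finite (move (motion (mat 1) v) ?P)"
        using P(1) by (simp add: move_def)
      ultimately have "fits S (mat 1) (move (motion (mat 1) v) ?P)"
        using repetitive_imp_fits[OF T rep S] by blast
      then have "fits S (mat 1) ?P"
        by (simp add: fits_move)
      then obtain w where "move (motion (mat 1) w) ?P \<subseteq> S"
        unfolding fits_def by blast
      then have sub: "?P \<subseteq> translate (- w) S"
        unfolding move_motion_subset_iff[OF rotation_matrix_mat_1]
        by (simp add: translation_eq_motion transpose_mat)
      have S': "translate (- w) S \<in> Omega_t T"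
        using S by (rule Omega_t_translate)
      then have "patch_at (translate (- w) S) (1 / e) 0 = ?P"
        using patch_at_eqI[OF tU _ sub] by (simp add: Omega_t_iff)
      then have "agree_after_small_motion e U (translate (- w) S)"
        unfolding agree_after_small_motion_def translation_eq_motion rotation_eq_motion
        using e(1) by (intro exI[of _ 0] exI[of _ "mat 1"])
          (simp add: rotation_matrix_mat_1 motion_mat_1_0 move_id)
      then have "translate (- w) S \<in> V"
        using e(2)[OF S'] by (simp add: close_tilings_def)
      then show ?thesis
        by blast
    qed
    then show "U \<in> tiling_topology (Omega_t T) closure_of range (\<lambda>v. translate v S)"
      unfolding in_closure_of topspace_tiling_topology using U by blast
  qed
qed

lemma Omega_t_tile:
  assumes "S \<in> Omega_t T" "s \<in> S"
  obtains t v where "t \<in> T" "fst t = motion (mat 1) v ` fst s"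
proof -
  have "fits T (mat 1) {s}"
    using assms by (auto simp: Omega_t_iff)
  then obtain v where v: "move (motion (mat 1) v) {s} \<subseteq> T"
    unfolding fits_def by blast
  then show ?thesis
    by (intro that[of "map_prod ((`) (motion (mat 1) v)) id s" v]) (auto simp: move_def)
qed

text \<open>Since only finitely many rotations carry a tile of \<open>T\<close> to a translate of a tile of \<open>T\<close>, none
  of them but the identity is close to the identity. So tilings with the tiles of \<open>T\<close> that are close to
  each other agree near the origin up to a translation alone.\<close>

lemma small_rotation_trivial:
  assumes T: "tiling T"
  shows "\<exists>d>0. \<forall>S\<in>Omega_t T. \<forall>S'\<in>Omega_t T. \<forall>s\<in>S. \<forall>s'\<in>S'. \<forall>A v.
    rotation_matrix A \<longrightarrow> motion A v ` fst s = fst s' \<longrightarrow> norm (A - mat 1) < d \<longrightarrow> A = mat 1"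
proof -
  define M where "M = {A. rotation_matrix A \<and> (\<exists>s\<in>T. \<exists>t\<in>T. \<exists>v. motion A v ` fst s = fst t)}"
  have "finite M"
    unfolding M_def by (rule finite_rotations_between_tilings[OF T T])
  then obtain d where d: "d > 0" "\<And>A. A \<in> M \<Longrightarrow> A \<noteq> mat 1 \<Longrightarrow> d \<le> dist (mat 1) A"
    using finite_set_avoid[of M "mat 1"] by blast
  show ?thesis
  proof (intro exI[of _ d] conjI ballI allI impI)
    show "d > 0"
      by (rule d(1))
    fix S S' s s' A v
    assume S: "S \<in> Omega_t T" "S' \<in> Omega_t T" "s \<in> S" "s' \<in> S'" and A: "rotation_matrix A"
      and eq: "motion A v ` fst s = fst s'" and small: "norm (A - mat 1) < d"
    obtain t u where t: "t \<in> T" "fst t = motion (mat 1) u ` fst s"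
      using Omega_t_tile[OF S(1,3)] .
    obtain t' u' where t': "t' \<in> T" "fst t' = motion (mat 1) u' ` fst s'"
      using Omega_t_tile[OF S(2,4)] .
    have "fst s = motion (mat 1) (- u) ` fst t"
      by (simp add: t(2) image_comp motion_comp motion_mat_1_0)
    then have "motion A (u' + (v + A *v (- u))) ` fst t = fst t'"
      unfolding t'(2) eq[symmetric] by (simp add: image_comp motion_comp)
    then have "A \<in> M"
      unfolding M_def using A t(1) t'(1) by blast
    then show "A = mat 1"
      using d(2) small by (metis dist_commute dist_norm not_le)
  qed
qed

lemma openin_fits:
  assumes T: "tiling T" and P: "finite P" "P \<noteq> {}"
  shows "openin (tiling_topology (Omega_t T)) {U \<in> Omega_t T. fits U (mat 1) P}"
  unfolding openin_tiling_topology
proof (intro conjI ballI)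
  fix U assume "U \<in> {U \<in> Omega_t T. fits U (mat 1) P}"
  then obtain z where U: "U \<in> Omega_t T" and z: "move (motion (mat 1) z) P \<subseteq> U"
    unfolding fits_def by blast
  define P' where "P' = move (motion (mat 1) z) P"
  have P': "finite P'" "P' \<subseteq> U"
    using z P by (auto simp: P'_def move_def)
  obtain p where p: "p \<in> P'"
    using P(2) by (auto simp: P'_def move_def)
  have fits_P: "fits S (mat 1) P" if "fits S (mat 1) P'" for S
    using that by (simp add: P'_def fits_move)
  have tU: "tiling U"
    using U by (simp add: Omega_t_iff)
  obtain r where r: "r > 0" "P' \<subseteq> patch_at U r 0" "\<And>t. t \<in> P' \<Longrightarrow> fst t \<subseteq> cball 0 r"
    using finite_subset_patch_at[OF tU P'] by metis
  obtain d where d: "d > 0" "\<forall>S\<in>Omega_t T. \<forall>S'\<in>Omega_t T. \<forall>s\<in>S. \<forall>s'\<in>S'. \<forall>A v.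
    rotation_matrix A \<longrightarrow> motion A v ` fst s = fst s' \<longrightarrow> norm (A - mat 1) < d \<longrightarrow> A = mat 1"
    using small_rotation_trivial[OF T] by (elim exE conjE)
  \<comment> \<open>a motion with translation part at most 1 keeps \<open>P'\<close> in the ball of radius \<open>r + 1 \<le> 1 / e\<close>\<close>
  define e where "e = min (min 1 d) (1 / (r + 1))"
  have e: "e > 0" "e \<le> 1" "e \<le> d" "r + 1 \<le> 1 / e"
  proof -
    show "e > 0" "e \<le> 1" "e \<le> d"
      using r(1) d(1) by (auto simp: e_def)
    have "e \<le> 1 / (r + 1)"
      by (simp add: e_def)
    then have "e * (r + 1) \<le> 1"
      using r(1) by (simp add: pos_le_divide_eq)
    then show "r + 1 \<le> 1 / e"
      using \<open>e > 0\<close> by (simp add: pos_le_divide_eq mult.commute)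
  qed
  have motion_eq: "rotate A (translate v X) = move (motion A (A *v v)) X" for A v and X :: "('a, 'b) tiling"
    unfolding translation_eq_motion move_compose
    by (rule arg_cong[of _ _ "\<lambda>f. move f X"]) (simp add: motion_def fun_eq_iff matrix_vector_right_distrib)
  have "fits U' (mat 1) P" if U': "U' \<in> Omega_t T" and close: "close_tilings e U U'" for U'
    using close unfolding close_tilings_def
  proof
    assume "agree_after_small_motion e U U'"
    then obtain v A where vA: "norm v < e" "rotation_matrix A" "norm (A - mat 1) < e"
        "patch_at (move (motion A (A *v v)) U) (1 / e) 0 = patch_at U' (1 / e) 0"
      unfolding agree_after_small_motion_def motion_eq by blast
    have "move (motion A (A *v v)) P' \<subseteq> patch_at (move (motion A (A *v v)) U) (1 / e) 0"
    proof
      fix t assume "t \<in> move (motion A (A *v v)) P'"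
      then obtain s where s: "s \<in> P'" "t = map_prod ((`) (motion A (A *v v))) id s"
        unfolding move_def by (rule imageE)
      obtain y where y: "y \<in> fst s"
        using tiling_tile_nonempty[OF tU] s(1) P'(2) by blast
      have "norm (motion A (A *v v) y) = norm (v + y)"
        using orthogonal_transformation_norm[OF orthogonal_transformation_rotation[OF vA(2)]]
        by (simp add: motion_def flip: matrix_vector_right_distrib)
      also have "\<dots> \<le> norm v + norm y"
        by (rule norm_triangle_ineq)
      also have "\<dots> \<le> 1 / e"
        using vA(1) e r(3)[OF s(1)] y by fastforce
      finally have "motion A (A *v v) y \<in> fst t \<inter> cball 0 (1 / e)"
        using s(2) y by simp
      then show "t \<in> patch_at (move (motion A (A *v v)) U) (1 / e) 0"
        using s P'(2) by (auto simp: patch_at_def move_def)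
    qed
    then have sub: "move (motion A (A *v v)) P' \<subseteq> U'"
      unfolding vA(4) by (auto simp: patch_at_def)
    have "map_prod ((`) (motion A (A *v v))) id p \<in> U'"
      using sub p unfolding move_def by blast
    then have "A = mat 1"
      using d(2)[rule_format, OF U U' _ _ vA(2), of p "map_prod ((`) (motion A (A *v v))) id p" "A *v v"]
        p P'(2) vA(3) e(3) by auto
    then have "fits U' (mat 1) P'"
      using sub unfolding fits_def by blast
    then show ?thesis
      by (rule fits_P)
  next
    assume "agree_after_small_motion e U' U"
    then obtain v A where vA: "norm v < e" "rotation_matrix A" "norm (A - mat 1) < e"
        "patch_at (move (motion A (A *v v)) U') (1 / e) 0 = patch_at U (1 / e) 0"
      unfolding agree_after_small_motion_def motion_eq by blast
    have "P' \<subseteq> patch_at U (1 / e) 0"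
    proof
      fix t assume t: "t \<in> P'"
      then have "t \<in> U"
        using P'(2) by blast
      have "fst t \<subseteq> cball 0 (1 / e)"
        using r(3)[OF t] e(4) subset_cball[of r "1 / e" 0] by auto
      then show "t \<in> patch_at U (1 / e) 0"
        using \<open>t \<in> U\<close> tiling_tile_nonempty[OF tU \<open>t \<in> U\<close>] by (auto simp: patch_at_def)
    qed
    then have sub: "P' \<subseteq> move (motion A (A *v v)) U'"
      unfolding vA(4)[symmetric] by (auto simp: patch_at_def)
    then have "p \<in> move (motion A (A *v v)) U'"
      using p by (rule subsetD)
    then obtain s where s: "s \<in> U'" "p = map_prod ((`) (motion A (A *v v))) id s"
      unfolding move_def by (rule imageE)
    then have "A = mat 1"
      using d(2)[rule_format, OF U' U _ _ vA(2), of s p "A *v v"] p P'(2) vA(3) e(3) by auto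
    then have "fits U' (mat 1) P'"
      using fits_subset[OF sub] vA(2) by (simp add: fits_move_tiling transpose_mat)
    then show ?thesis
      by (rule fits_P)
  qed
  then show "\<exists>e>0. \<forall>S'\<in>Omega_t T. close_tilings e U S' \<longrightarrow> S' \<in> {U \<in> Omega_t T. fits U (mat 1) P}"
    using e(1) by blast
qed blast

lemma minimal_imp_fits:
  assumes T: "tiling T" and min: "minimal_system (Omega_t T)" and S: "S \<in> Omega_t T"
    and P: "finite P" "P \<subseteq> T"
  shows "fits S (mat 1) P"
proof (cases "P = {}")
  case True
  then show ?thesis
    by (simp add: fits_def move_def)
next
  case False
  have "T \<in> tiling_topology (Omega_t T) closure_of range (\<lambda>v. translate v S)"
    using min S Omega_t_self[OF T] by (simp add: minimal_system_def)
  moreover have "T \<in> {U \<in> Omega_t T. fits U (mat 1) P}"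
    using Omega_t_self[OF T] fits_subset[OF P(2)] by simp
  ultimately obtain S' where "S' \<in> range (\<lambda>v. translate v S)" "S' \<in> {U \<in> Omega_t T. fits U (mat 1) P}"
    using openin_fits[OF T P(1) False] unfolding in_closure_of by meson
  then obtain w where "fits (translate w S) (mat 1) P"
    by auto
  then show ?thesis
    by (simp add: translation_eq_motion fits_move_tiling rotation_matrix_mat_1 transpose_mat)
qed

text \<open>A point of \<open>S\<close> that is extreme in direction \<open>d\<close> cannot be moved further in this direction.\<close>

lemma compact_translation_invariant:
  fixes S :: "'a::euclidean_space set"
  assumes "compact S" "S \<noteq> {}" "(+) d ` S \<subseteq> S"
  shows "d = 0"
proof -
  have "continuous_on S (\<lambda>y. y \<bullet> d)"
    by (intro continuous_intros)
  then obtain x where x: "x \<in> S" "\<And>y. y \<in> S \<Longrightarrow> y \<bullet> d \<le> x \<bullet> d"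
    using continuous_attains_sup[OF assms(1,2)] by meson
  then have "(d + x) \<bullet> d \<le> x \<bullet> d"
    using assms(3) by blast
  then have "d \<bullet> d \<le> 0"
    by (simp add: inner_add_left)
  then show "d = 0"
    using inner_gt_zero_iff[of d] by linarith
qed

text \<open>Finite local complexity gives a limit of \<open>T\<close> seen from the points \<open>y n\<close>. Shift the origin
  from \<open>y n\<close> by a bounded amount such that a fixed tile \<open>p\<close> occurs at the same place in all of
  infinitely many of the shifted tilings. Then for each radius only finitely many patches occur around the
  origin, and a diagonal choice of nested infinite index sets yields a tiling whose patches all
  occur infinitely often near the points \<open>y n\<close>.\<close>

proposition flc_limit_tiling:
  fixes T :: "('n::finite, 'l) tiling" and y :: "nat \<Rightarrow> real^'n"
  assumes T: "tiling T" and flc: "flc T"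
  shows "\<exists>S\<in>Omega_t T. \<exists>D. \<forall>P. finite P \<longrightarrow> P \<subseteq> S \<longrightarrow>
    infinite {n. \<exists>v. dist v (y n) \<le> D \<and> translate v P \<subseteq> T}"
proof -
  obtain Q where Q: "finite Q" "Q \<subseteq> T"
    "\<And>t. t \<in> T \<Longrightarrow> \<exists>q\<in>Q. \<exists>v. t = map_prod ((`) (motion (mat 1) v)) id q"
    using tiling_prototiles[OF T] by blast
  have "\<exists>q v. q \<in> Q \<and> map_prod ((`) (motion (mat 1) v)) id q \<in> T \<and> y n \<in> motion (mat 1) v ` fst q" for n
  proof -
    obtain t where t: "t \<in> T" "y n \<in> fst t"
      using tiling_covers[OF T] .
    moreover obtain q v where "q \<in> Q" "t = map_prod ((`) (motion (mat 1) v)) id q"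
      using Q(3)[OF t(1)] by blast
    ultimately show ?thesis
      by (intro exI[of _ q] exI[of _ v]) simp
  qed
  then obtain q v where qv: "\<And>n. q n \<in> Q" "\<And>n. map_prod ((`) (motion (mat 1) (v n))) id (q n) \<in> T"
      "\<And>n. y n \<in> motion (mat 1) (v n) ` fst (q n)"
    by metis
  have "finite (q ` UNIV)"
    using qv(1) Q(1) by (metis finite_subset image_subsetI)
  then obtain n0 where n0: "infinite {n \<in> UNIV. q n = q n0}"
    using pigeonhole_infinite[OF infinite_UNIV_nat] by blast
  define p where "p = q n0"
  define N0 where "N0 = {n. q n = p}"
  have N0: "infinite N0"
    using n0 by (simp add: N0_def p_def)
  have body: "polyhedral_body (fst p)"
    using tiling_polyhedral_body[OF T] qv(1) Q(2) unfolding p_def by blast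
  have "finite {p}" "{p} \<subseteq> T"
    using qv(1) Q(2) unfolding p_def by auto
  then obtain D where D: "D > 0" "{p} \<subseteq> patch_at T D 0" "\<And>t. t \<in> {p} \<Longrightarrow> fst t \<subseteq> cball 0 D"
    using finite_subset_patch_at[OF T] by metis
  have p_D: "fst p \<subseteq> cball 0 D"
    using D(3) by simp
  have dist_v: "dist (v n) (y n) \<le> D" if "n \<in> N0" for n
  proof -
    have "q n = p"
      using that by (simp add: N0_def)
    then obtain x where "x \<in> fst p" "y n = v n + x"
      using qv(3)[of n] by (auto simp: motion_def)
    then show ?thesis
      using p_D by (auto simp: dist_norm)
  qed
  define Tn where "Tn n = move (motion (mat 1) (- v n)) T" for n
  have tTn: "tiling (Tn n)" for n
    unfolding Tn_def by (rule tiling_move[OF rotation_matrix_mat_1 T])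
  have translate_Tn: "translate (v n) P \<subseteq> T \<longleftrightarrow> P \<subseteq> Tn n" for n P
    unfolding Tn_def translation_eq_motion move_motion_subset_iff[OF rotation_matrix_mat_1]
    by (simp add: transpose_mat)
  have p_Tn: "p \<in> Tn n" if "n \<in> N0" for n
    using translate_Tn[of n "{p}"] qv(2)[of n] that by (simp add: N0_def move_def translation_eq_motion)
  \<comment> \<open>the radii are at least \<open>D\<close>, so that all these patches contain \<open>p\<close>\<close>
  define pat where "pat m n = patch_at (Tn n) (D + real m) 0" for m n
  have pat_sub: "pat m n \<subseteq> Tn n" for m n
    by (auto simp: pat_def patch_at_def)
  have fin: "finite (pat m ` N0)" for m
  proof -
    have "D + real m > 0"
      using D(1) by simp
    then obtain F where F: "finite F" "\<And>P. r_patch T (D + real m) P \<Longrightarrow> \<exists>Q\<in>F. \<exists>v. P = translate v Q"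
      using flc unfolding flc_def by meson
    \<comment> \<open>the position of a translate of \<open>X\<close> is determined by the tile of \<open>X\<close> that is moved to \<open>p\<close>\<close>
    let ?G = "\<Union>X\<in>{X \<in> F. finite X}. \<Union>t\<in>X. (\<lambda>u. move (motion (mat 1) u) X) `
        {u. map_prod ((`) (motion (mat 1) u)) id t = p}"
    have "finite {u. map_prod ((`) (motion (mat 1) u)) id t = p}" for t
    proof (cases "\<exists>u. map_prod ((`) (motion (mat 1) u)) id t = p")
      case True
      then obtain u where u: "map_prod ((`) (motion (mat 1) u)) id t = p"
        by blast
      have "u' = u" if "map_prod ((`) (motion (mat 1) u')) id t = p" for u'
      proof -
        have "fst p = (+) u ` fst t" "fst p = (+) u' ` fst t"
          using arg_cong[OF u, of fst] arg_cong[OF that, of fst]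
          by (simp_all add: translation_eq_motion)
        moreover have "(+) (u' - u) ` (+) u ` fst t = (+) u' ` fst t"
          by (simp add: image_image)
        ultimately have "(+) (u' - u) ` fst p = fst p"
          by simp
        moreover have "fst p \<noteq> {}"
          using polyhedral_body_interior_nonempty[OF body] interior_subset by blast
        ultimately show ?thesis
          using compact_translation_invariant[OF polyhedral_body_compact[OF body], of "u' - u"]
          by simp
      qed
      then have "{u. map_prod ((`) (motion (mat 1) u)) id t = p} \<subseteq> {u}"
        by blast
      then show ?thesis
        using finite_subset by blast
    qed simp
    then have "finite ?G"
      using F(1) by (intro finite_UN_I finite_imageI) auto
    moreover have "pat m ` N0 \<subseteq> ?G"
    proof clarify
      fix n assume n: "n \<in> N0"
      have eq: "pat m n = move (motion (mat 1) (- v n)) (patch_at T (D + real m) (v n))"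
        using patch_at_move[OF rotation_matrix_mat_1, of "- v n" T "D + real m" "v n"]
        by (simp add: pat_def Tn_def motion_def)
      obtain X u where X: "X \<in> F" "patch_at T (D + real m) (v n) = translate u X"
        using F(2)[of "patch_at T (D + real m) (v n)"] by (auto simp: r_patch_def)
      have pat_eq: "pat m n = move (motion (mat 1) (- v n + u)) X"
        unfolding eq X(2) translation_eq_motion move_motion by simp
      have finX: "finite X"
        using finite_patch_at[OF T, of "D + real m" "v n"] unfolding X(2)
        by (simp add: finite_move_iff)
      have "p \<in> pat m n"
      proof -
        obtain x where "x \<in> fst p"
          using polyhedral_body_interior_nonempty[OF body] interior_subset by blast
        then have "x \<in> fst p \<inter> cball 0 (D + real m)"
          using p_D subset_cball[of D "D + real m" 0] by auto
        then show ?thesis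
          using p_Tn[OF n] by (auto simp: pat_def patch_at_def)
      qed
      then obtain t where "t \<in> X" "p = map_prod ((`) (motion (mat 1) (- v n + u))) id t"
        unfolding pat_eq move_def by (rule imageE)
      then show "pat m n \<in> ?G"
        using X(1) finX pat_eq by blast
    qed
    ultimately show ?thesis
      using finite_subset by blast
  qed
  have step: "\<exists>N'. N' \<subseteq> N \<and> infinite N' \<and> (\<forall>i\<in>N'. \<forall>j\<in>N'. pat m i = pat m j)"
    if N: "N \<subseteq> N0" "infinite N" for N m
  proof -
    have "finite (pat m ` N)"
      using fin[of m] N(1) by (meson finite_subset image_mono)
    then obtain a where "infinite {n \<in> N. pat m n = pat m a}"
      using pigeonhole_infinite[OF N(2)] by blast
    then show ?thesis
      by (intro exI[of _ "{n \<in> N. pat m n = pat m a}"]) auto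
  qed
  have "\<exists>f. \<forall>m. (f m \<subseteq> N0 \<and> infinite (f m) \<and> (\<forall>i\<in>f m. \<forall>j\<in>f m. pat m i = pat m j)) \<and> f (Suc m) \<subseteq> f m"
  proof (rule dependent_nat_choice)
    show "\<exists>N. N \<subseteq> N0 \<and> infinite N \<and> (\<forall>i\<in>N. \<forall>j\<in>N. pat 0 i = pat 0 j)"
      using step[OF subset_refl N0] .
    show "\<exists>N'. (N' \<subseteq> N0 \<and> infinite N' \<and> (\<forall>i\<in>N'. \<forall>j\<in>N'. pat (Suc m) i = pat (Suc m) j)) \<and> N' \<subseteq> N"
      if "N \<subseteq> N0 \<and> infinite N \<and> (\<forall>i\<in>N. \<forall>j\<in>N. pat m i = pat m j)" for N m
      using step[of N "Suc m"] that by (meson subset_trans)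
  qed
  then obtain f where f: "\<And>m. f m \<subseteq> N0" "\<And>m. infinite (f m)"
      "\<And>m i j. i \<in> f m \<Longrightarrow> j \<in> f m \<Longrightarrow> pat m i = pat m j" "\<And>m. f (Suc m) \<subseteq> f m"
    by metis
  have f_anti: "f m' \<subseteq> f m" if "m \<le> m'" for m m'
    using lift_Suc_antimono_le[of f, OF f(4) that] .
  define W where "W m = pat m (SOME n. n \<in> f m)" for m
  have W: "pat m n = W m" if "n \<in> f m" for m n
    unfolding W_def using that by (intro f(3)[of n m]) (auto intro: someI)
  have nonempty: "\<exists>n. n \<in> f m" for m
    unfolding ex_in_conv by (rule infinite_imp_nonempty[OF f(2)])
  have W_mono: "W m \<subseteq> W m'" if le: "m \<le> m'" for m m'
  proof -
    obtain n where "n \<in> f m'" "n \<in> f m"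
      using nonempty[of m'] f_anti[OF le] by blast
    moreover have "pat m n \<subseteq> pat m' n"
      unfolding pat_def patch_at_def using subset_cball[of "D + real m" "D + real m'" 0] le by auto
    ultimately show ?thesis
      using W by metis
  qed
  define S where "S = (\<Union>m. W m)"
  have finite_sub: "\<exists>m. P \<subseteq> W m" if "finite P" "P \<subseteq> S" for P
    using that
  proof (induction P)
    case (insert t P)
    then obtain m m' where "P \<subseteq> W m" "t \<in> W m'"
      by (auto simp: S_def)
    then have "insert t P \<subseteq> W (max m m')"
      using W_mono[of m "max m m'"] W_mono[of m' "max m m'"] by auto
    then show ?case
      by blast
  qed simp
  have inf: "infinite {n. \<exists>v. dist v (y n) \<le> D \<and> translate v P \<subseteq> T}" if P: "finite P" "P \<subseteq> S" for P
  proof -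
    obtain m where m: "P \<subseteq> W m"
      using finite_sub[OF P] by blast
    have "f m \<subseteq> {n. \<exists>v. dist v (y n) \<le> D \<and> translate v P \<subseteq> T}"
    proof
      fix n assume n: "n \<in> f m"
      have "P \<subseteq> Tn n"
        using m W[OF n] pat_sub[of m n] by blast
      then have "translate (v n) P \<subseteq> T"
        by (simp only: translate_Tn)
      moreover have "dist (v n) (y n) \<le> D"
        using dist_v n f(1) by blast
      ultimately show "n \<in> {n. \<exists>v. dist v (y n) \<le> D \<and> translate v P \<subseteq> T}"
        by blast
    qed
    then show ?thesis
      using f(2)[of m] finite_subset by blast
  qed
  have common: "\<exists>n. P \<subseteq> Tn n" if P: "finite P" "P \<subseteq> S" for P
  proof -
    obtain m where m: "P \<subseteq> W m"
      using finite_sub[OF P] by blast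
    obtain n where "n \<in> f m"
      using nonempty by blast
    then show ?thesis
      using m W pat_sub by (metis order_trans)
  qed
  have "tiling S"
    unfolding tiling_def
  proof (intro conjI ballI impI)
    fix t assume "t \<in> S"
    then obtain n where "t \<in> Tn n"
      using common[of "{t}"] by auto
    then show "polyhedral_body (fst t)"
      by (rule tiling_polyhedral_body[OF tTn])
  next
    have "x \<in> (\<Union>t\<in>S. fst t)" for x
    proof -
      obtain m where m: "norm x \<le> real m"
        using real_arch_simple by blast
      obtain n where n: "n \<in> f m"
        using nonempty by blast
      obtain t where t: "t \<in> Tn n" "x \<in> fst t"
        using tiling_covers[OF tTn] .
      have "x \<in> fst t \<inter> cball 0 (D + real m)"
        using t(2) m D(1) by simp
      then have "t \<in> pat m n"
        using t(1) by (auto simp: pat_def patch_at_def)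
      then show ?thesis
        using W[OF n] t(2) by (auto simp: S_def)
    qed
    then show "(\<Union>t\<in>S. fst t) = UNIV"
      by blast
  next
    fix s t assume st: "s \<in> S" "t \<in> S" "s \<noteq> t"
    then obtain n where "{s, t} \<subseteq> Tn n"
      using common[of "{s, t}"] by auto
    then show "fst s \<inter> fst t \<subseteq> frontier (fst s) \<inter> frontier (fst t)"
        "face_to_face (fst s) (fst t)"
      using tTn[of n] st(3) unfolding tiling_def by blast+
  next
    have "\<exists>q\<in>Q. \<exists>v. t = ((+) v ` fst q, snd q)" if t: "t \<in> S" for t
    proof -
      obtain n where "{t} \<subseteq> Tn n"
        using common[of "{t}"] t by auto
      then have "map_prod ((`) ((+) (v n))) id t \<in> T"
        using translate_Tn[of n "{t}"] by (simp add: move_def)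
      then obtain q w where q: "q \<in> Q"
          "map_prod ((`) ((+) (v n))) id t = map_prod ((`) (motion (mat 1) w)) id q"
        using Q(3) by blast
      have "(+) (v n) ` fst t = (+) w ` fst q" "snd t = snd q"
        using arg_cong[OF q(2), of fst] arg_cong[OF q(2), of snd] by (simp_all add: translation_eq_motion)
      have "fst t = (+) (- v n) ` (+) (v n) ` fst t"
        by (simp add: image_image)
      also have "\<dots> = (+) (w + - v n) ` fst q"
        by (simp only: \<open>(+) (v n) ` fst t = (+) w ` fst q\<close> translation_assoc)
      finally have "t = ((+) (w + - v n) ` fst q, snd q)"
        using \<open>snd t = snd q\<close> by (simp add: prod_eq_iff)
      then show ?thesis
        using q(1) by blast
    qed
    then show "\<exists>Q. finite Q \<and> (\<forall>t\<in>S. \<exists>q\<in>Q. \<exists>v. t = ((+) v ` fst q, snd q))"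
      using Q(1) by blast
  qed
  moreover have "fits T (mat 1) P" if "finite P" "P \<subseteq> S" for P
    using infinite_imp_nonempty[OF inf[OF that]] unfolding fits_def translation_eq_motion by blast
  ultimately have "S \<in> Omega_t T"
    by (simp add: Omega_t_iff)
  then show ?thesis
    using inf by blast
qed

text \<open>If some patch had no copy in arbitrarily large balls of \<open>T\<close>, it would have none in the
  limit of \<open>T\<close> seen from the centres of these balls. As there are only finitely many \<open>r\<close>-patches up to
  translation, one radius \<open>R\<close> serves for all of them.\<close>

lemma fits_imp_repetitive:
  fixes T :: "('n::finite, 'l) tiling"
  assumes T: "tiling T" and flc: "flc T"
    and fits: "\<And>S P. S \<in> Omega_t T \<Longrightarrow> finite P \<Longrightarrow> P \<subseteq> T \<Longrightarrow> fits S (mat 1) P"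
  shows "repetitive T"
proof -
  define found where "found P R \<longleftrightarrow> (\<forall>y. \<exists>v. translate v P \<subseteq> T \<and> (\<forall>t\<in>translate v P. fst t \<subseteq> cball y R))"
    for P and R :: real
  have found_mono: "found P R'" if "found P R" "R \<le> R'" for P R R'
    using that subset_cball[OF that(2)] unfolding found_def by (meson order_trans)
  have found_translate: "found (translate u P) R \<longleftrightarrow> found P R" for u P R
  proof -
    have 1: "translate v (translate u P) = translate (v + u) P" for v
      unfolding translation_eq_motion move_motion by simp
    show ?thesis
      unfolding found_def 1 by (metis diff_add_cancel)
  qed
  have ex_R: "\<exists>R. found P R" if P: "finite P" "P \<subseteq> T" for P
  proof (rule ccontr)
    assume "\<nexists>R. found P R"
    then have "\<exists>y. \<nexists>v. translate v P \<subseteq> T \<and> (\<forall>t\<in>translate v P. fst t \<subseteq> cball y (real n))" for n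
      unfolding found_def by blast
    then obtain y where y: "\<And>n v. \<not> (translate v P \<subseteq> T \<and> (\<forall>t\<in>translate v P. fst t \<subseteq> cball (y n) (real n)))"
      by metis
    obtain S where S: "S \<in> Omega_t T" "\<exists>D. \<forall>P. finite P \<longrightarrow> P \<subseteq> S \<longrightarrow>
        infinite {n. \<exists>v. dist v (y n) \<le> D \<and> translate v P \<subseteq> T}"
      using flc_limit_tiling[OF T flc, of y] by (rule bexE)
    obtain D where D: "\<forall>P. finite P \<longrightarrow> P \<subseteq> S \<longrightarrow>
        infinite {n. \<exists>v. dist v (y n) \<le> D \<and> translate v P \<subseteq> T}"
      using S(2) by (rule exE)
    obtain z where "move (motion (mat 1) z) P \<subseteq> S"
      using fits[OF S(1) P] unfolding fits_def by blast
    then have z: "translate z P \<subseteq> S"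
      by (simp only: translation_eq_motion)
    have fin: "finite (translate z P)"
      using P(1) by (simp add: move_def)
    have "tiling S"
      using S(1) by (simp add: Omega_t_iff)
    then obtain r where "r > 0" "translate z P \<subseteq> patch_at S r 0"
      and r: "\<And>t. t \<in> translate z P \<Longrightarrow> fst t \<subseteq> cball 0 r"
      using finite_subset_patch_at[OF _ fin z] by metis
    obtain k :: nat where k: "r + D \<le> real k"
      using real_arch_simple by blast
    obtain n where n: "k \<le> n" "n \<in> {n. \<exists>v. dist v (y n) \<le> D \<and> translate v (translate z P) \<subseteq> T}"
      using D[rule_format, OF fin z] unfolding infinite_nat_iff_unbounded_le by blast
    then obtain v where v: "dist v (y n) \<le> D" "translate v (translate z P) \<subseteq> T"
      by blast
    have eq: "translate v (translate z P) = translate (v + z) P"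
      unfolding translation_eq_motion move_motion by simp
    have "fst t \<subseteq> cball (y n) (real n)" if "t \<in> translate (v + z) P" for t
    proof
      obtain s where s: "s \<in> translate z P" "t = map_prod ((`) ((+) v)) id s"
        using \<open>t \<in> translate (v + z) P\<close> unfolding eq[symmetric] unfolding move_def[of "(+) v"] by (rule imageE)
      fix x assume "x \<in> fst t"
      then obtain x' where x': "x' \<in> fst s" "x = v + x'"
        using s(2) by auto
      have "dist (y n) x \<le> dist (y n) v + dist v x"
        by (rule dist_triangle)
      also have "\<dots> \<le> D + r"
        using v(1) r[OF s(1)] x' by (intro add_mono) (auto simp: dist_commute dist_norm)
      finally show "x \<in> cball (y n) (real n)"
        using k n(1) by simp
    qed
    then show False
      using y[of "v + z" n] v(2) unfolding eq by blast
  qed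
  show ?thesis
    unfolding repetitive_def
  proof (intro allI impI)
    fix r :: real assume "r > 0"
    then obtain F where F: "finite F" "\<And>P. r_patch T r P \<Longrightarrow> \<exists>Q\<in>F. \<exists>v. P = translate v Q"
      using flc unfolding flc_def by meson
    have r_patch_sub: "finite P \<and> P \<subseteq> T" if "r_patch T r P" for P
      using that finite_patch_at[OF T] by (auto simp: r_patch_def patch_at_def)
    have "\<exists>R. \<forall>u. r_patch T r (translate u Q) \<longrightarrow> found Q R" for Q
    proof (cases "\<exists>u. r_patch T r (translate u Q)")
      case True
      then obtain u where "r_patch T r (translate u Q)"
        by blast
      then obtain R where "found (translate u Q) R"
        using ex_R r_patch_sub by blast
      then show ?thesis
        by (auto simp: found_translate)
    qed blast
    then obtain R where R: "\<And>Q u. r_patch T r (translate u Q) \<Longrightarrow> found Q (R Q)"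
      by metis
    have found: "found P (Max (insert 1 (R ` F)))" if P: "r_patch T r P" for P
    proof -
      obtain Q u where Q: "Q \<in> F" "P = translate u Q"
        using F(2)[OF P] by blast
      then have "found P (R Q)"
        using R P by (simp add: found_translate)
      moreover have "R Q \<le> Max (insert 1 (R ` F))"
        using F(1) Q(1) by simp
      ultimately show ?thesis
        by (rule found_mono)
    qed
    show "\<exists>R>0. \<forall>P. r_patch T r P \<longrightarrow>
        (\<forall>y. \<exists>v. patch T (translate v P) \<and> (\<forall>t\<in>translate v P. fst t \<subseteq> cball y R))"
    proof (intro exI[of _ "Max (insert 1 (R ` F))"] conjI allI impI)
      show "0 < Max (insert 1 (R ` F))"
        using F(1) by (simp add: Max_gr_iff)
      fix P and y :: "real^'n" assume P: "r_patch T r P"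
      obtain v where "translate v P \<subseteq> T" "\<forall>t\<in>translate v P. fst t \<subseteq> cball y (Max (insert 1 (R ` F)))"
        using found[OF P] unfolding found_def by blast
      moreover have "finite (translate v P)"
        using r_patch_sub[OF P] by (simp add: move_def)
      ultimately show "\<exists>v. patch T (translate v P) \<and>
          (\<forall>t\<in>translate v P. fst t \<subseteq> cball y (Max (insert 1 (R ` F))))"
        unfolding patch_def by blast
    qed
  qed
qed

theorem repetitive_iff_minimal:
  assumes "tiling T" "flc T"
  shows "repetitive T \<longleftrightarrow> minimal_system (Omega_t T)"
  using repetitive_imp_minimal fits_imp_repetitive minimal_imp_fits assms by blast

section \<open>Point groups\<close>

lemma acts_by_rotations_iff:
  "acts_by_rotations G T \<longleftrightarrow> finite G \<and> subgroup G SO \<and>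
     (\<forall>g\<in>G. \<forall>P. finite P \<longrightarrow> P \<subseteq> T \<longrightarrow> fits T g P)"
proof -
  have "appears_up_to_translation T (rotate g P) \<longleftrightarrow> finite P \<and> fits T g P"
    if "subgroup G SO" "g \<in> G" for g P
    using that by (intro appears_rotate_iff) (simp add: subgroup_SO_iff)
  then show ?thesis
    unfolding acts_by_rotations_def patch_def by blast
qed

lemma has_point_group_iff:
  assumes "tiling T"
  shows "has_point_group T G \<longleftrightarrow> acts_by_rotations G T \<and>
    (\<exists>r>0. \<forall>x g. rotation_matrix g \<longrightarrow> fits T g (patch_at T r x) \<longrightarrow> g \<in> G)"
proof -
  have "(\<forall>P g. r_patch T r P \<longrightarrow> g \<in> carrier SO \<longrightarrow>
          appears_up_to_translation T (rotate g P) \<longrightarrow> g \<in> G) \<longleftrightarrow>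
      (\<forall>x g. rotation_matrix g \<longrightarrow> fits T g (patch_at T r x) \<longrightarrow> g \<in> G)" for r
    using finite_patch_at[OF assms] appears_rotate_iff[of _ T]
    unfolding r_patch_def carrier_SO mem_Collect_eq by metis
  then show ?thesis
    unfolding has_point_group_def by simp
qed

lemma antimono_finite_stabilizes:
  fixes H :: "nat \<Rightarrow> 'a set"
  assumes "antimono H" "finite (H 0)"
  obtains n where "\<And>m. m \<ge> n \<Longrightarrow> H m = H n"
proof -
  have fin: "finite (H n)" for n
    using assms by (metis antimonoD finite_subset zero_le)
  obtain n where n: "\<And>m. card (H n) \<le> card (H m)"
    using ex_has_least_nat[of "\<lambda>_. True" _ "\<lambda>n. card (H n)"] by blast
  have "H m = H n" if "m \<ge> n" for m
    using card_seteq[OF fin antimonoD[OF assms(1) that] n] .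
  then show thesis
    by (rule that)
qed

text \<open>The rotations that carry some patch of radius \<open>n\<close> to a patch of \<open>T\<close> form a decreasing
  sequence of finite sets. Where it becomes constant it consists of the rotations that do so for
  arbitrarily large patches. By repetitivity every patch occurs in such a large patch, so that
  these rotations carry all patches of \<open>T\<close> to patches of \<open>T\<close>, and hence form a group.\<close>

proposition repetitive_has_point_group:
  fixes T :: "('n::finite, 'l) tiling"
  assumes T: "tiling T" and rep: "repetitive T"
  obtains G where "has_point_group T G"
proof -
  define H where "H n = {g. rotation_matrix g \<and> (\<exists>x. fits T g (patch_at T (real n) x))}" for n
  have "antimono H"
  proof (rule antimonoI)
    fix m n :: nat assume "m \<le> n"
    then have "patch_at T (real m) x \<subseteq> patch_at T (real n) x" for x
      using subset_cball[of "real m" "real n" x] by (auto simp: patch_at_def)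
    then show "H n \<subseteq> H m"
      unfolding H_def using fits_mono by blast
  qed
  moreover have "finite (H 0)"
    using finite_rotations_fits[OF T T] by (simp add: H_def)
  ultimately obtain n where n: "\<And>m. m \<ge> n \<Longrightarrow> H m = H n"
    using antimono_finite_stabilizes by blast
  define G where "G = H n"
  have rot: "rotation_matrix g" if "g \<in> G" for g
    using that by (simp add: G_def H_def)
  have acts: "fits T g P" if g: "g \<in> G" and P: "finite P" "P \<subseteq> T" for g P
  proof -
    obtain r where r: "r > 0" "P \<subseteq> patch_at T r 0" "\<And>t. t \<in> P \<Longrightarrow> fst t \<subseteq> cball 0 r"
      using finite_subset_patch_at[OF T P] by metis
    obtain R where R: "\<And>y. fits (patch_at T R y) (mat 1) (patch_at T r 0)"
      using repetitive_fits_patch[OF T rep r(1)] by blast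
    obtain k :: nat where k: "R \<le> real k"
      using real_arch_simple by blast
    have "g \<in> H (max k n)"
      using n[of "max k n"] g by (simp add: G_def)
    then obtain x where x: "fits T g (patch_at T (real (max k n)) x)"
      by (auto simp: H_def)
    have "patch_at T R x \<subseteq> patch_at T (real (max k n)) x"
      using subset_cball[of R "real (max k n)" x] k by (auto simp: patch_at_def)
    then have fR: "fits T g (patch_at T R x)"
      using x fits_mono by blast
    obtain v where "move (motion (mat 1) v) (patch_at T r 0) \<subseteq> patch_at T R x"
      using R[of x] unfolding fits_def by blast
    then have "fits T g (move (motion (mat 1) v) (patch_at T r 0))"
      using fR fits_mono by blast
    then have "fits T g (patch_at T r 0)"
      by (simp add: fits_move)
    then show ?thesis
      using r(2) fits_mono by blast
  qed
  have in_G: "g \<in> G" if "rotation_matrix g" "fits T g (patch_at T (real n) x)" for g x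
    using that by (auto simp: G_def H_def)
  have patch_n: "finite (patch_at T (real n) x)" "patch_at T (real n) x \<subseteq> T" for x
    using finite_patch_at[OF T] by (auto simp: patch_at_def)
  have "finite G"
    using \<open>finite (H 0)\<close> antimonoD[OF \<open>antimono H\<close>, of 0 n] finite_subset by (auto simp: G_def)
  then have "subgroup G SO"
  proof (rule finite_closed_imp_subgroup_SO)
    show "mat 1 \<in> G"
      using in_G rotation_matrix_mat_1 fits_subset patch_n(2) by blast
    fix A B assume AB: "A \<in> G" "B \<in> G"
    obtain v where v: "move (motion B v) (patch_at T (real n) 0) \<subseteq> T"
      using acts[OF AB(2) patch_n] unfolding fits_def by blast
    have "finite (move (motion B v) (patch_at T (real n) 0))"
      using patch_n(1) by (simp add: move_def)
    then have "fits T A (move (motion B v) (patch_at T (real n) 0))"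
      using acts[OF AB(1)] v by blast
    then have "fits T (A ** B) (patch_at T (real n) 0)"
      by (simp add: fits_move)
    then show "A ** B \<in> G"
      using in_G rotation_matrix_mult rot AB by blast
  qed (rule rot)
  then have "acts_by_rotations G T"
    using \<open>finite G\<close> acts by (simp add: acts_by_rotations_iff)
  \<comment> \<open>the radius of a patch has to be positive, and \<open>n\<close> may be zero\<close>
  moreover have "\<forall>x g. rotation_matrix g \<longrightarrow> fits T g (patch_at T (real (Suc n)) x) \<longrightarrow> g \<in> G"
  proof (intro allI impI)
    fix x g assume "rotation_matrix g" "fits T g (patch_at T (real (Suc n)) x)"
    then have "g \<in> H (Suc n)"
      unfolding H_def by blast
    then show "g \<in> G"
      using n[of "Suc n"] by (simp add: G_def)
  qed
  moreover have "real (Suc n) > 0"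
    by simp
  ultimately have "has_point_group T G"
    unfolding has_point_group_iff[OF T] by blast
  then show thesis
    by (rule that)
qed

text \<open>Patches at a point correspond as well: the copy in \<open>T\<close> of an \<open>r\<close>-patch of \<open>S\<close> is an \<open>r\<close>-patch
  of \<open>T\<close>, by \<open>patch_at_eqI\<close>.\<close>

lemma has_point_group_same_patches:
  assumes T: "tiling T" and S: "tiling S"
    and ST: "\<And>P. finite P \<Longrightarrow> P \<subseteq> S \<Longrightarrow> fits T (mat 1) P"
    and TS: "\<And>P. finite P \<Longrightarrow> P \<subseteq> T \<Longrightarrow> fits S (mat 1) P"
    and G: "has_point_group T G"
  shows "has_point_group S G"
proof -
  have transfer: "fits Y g P"
    if XY: "\<And>P. finite P \<Longrightarrow> P \<subseteq> X \<Longrightarrow> fits Y (mat 1) P" and P: "finite P" "fits X g P"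
    for X Y :: "('a, 'b) tiling" and g P
  proof -
    obtain w where "move (motion g w) P \<subseteq> X"
      using P(2) unfolding fits_def by blast
    moreover have "finite (move (motion g w) P)"
      using P(1) by (simp add: move_def)
    ultimately have "fits Y (mat 1) (move (motion g w) P)"
      using XY by blast
    then show ?thesis
      by (simp add: fits_move)
  qed
  have "fits S g P" if g: "g \<in> G" and P: "finite P" "P \<subseteq> S" for g P
  proof -
    obtain v where v: "move (motion (mat 1) v) P \<subseteq> T"
      using ST[OF P] unfolding fits_def by blast
    have "finite (move (motion (mat 1) v) P)"
      using P(1) by (simp add: move_def)
    then have "fits T g (move (motion (mat 1) v) P)"
      using G g v by (simp add: has_point_group_def acts_by_rotations_iff)
    then have "fits T g P"
      by (simp add: fits_move)
    then show ?thesis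
      using transfer[OF TS P(1)] by blast
  qed
  then have acts: "acts_by_rotations G S"
    using G by (simp add: has_point_group_def acts_by_rotations_iff)
  obtain r where r: "r > 0" "\<And>x g. rotation_matrix g \<Longrightarrow> fits T g (patch_at T r x) \<Longrightarrow> g \<in> G"
    using G unfolding has_point_group_iff[OF T] by blast
  have "g \<in> G" if g: "rotation_matrix g" and fit: "fits S g (patch_at S r x)" for g x
  proof -
    have P: "finite (patch_at S r x)" "patch_at S r x \<subseteq> S"
      using finite_patch_at[OF S] by (auto simp: patch_at_def)
    obtain v where v: "move (motion (mat 1) v) (patch_at S r x) \<subseteq> T"
      using ST[OF P] unfolding fits_def by blast
    have eq: "patch_at (move (motion (mat 1) v) S) r (motion (mat 1) v x) =
        move (motion (mat 1) v) (patch_at S r x)"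
      by (rule patch_at_move[OF rotation_matrix_mat_1])
    have "patch_at T r (motion (mat 1) v x) = move (motion (mat 1) v) (patch_at S r x)"
      using patch_at_eqI[OF tiling_move[OF rotation_matrix_mat_1 S] T] v unfolding eq[symmetric] .
    moreover have "fits T g (move (motion (mat 1) v) (patch_at S r x))"
      using transfer[OF ST P(1) fit] by (simp add: fits_move)
    ultimately show ?thesis
      using r(2)[OF g] by metis
  qed
  then show ?thesis
    unfolding has_point_group_iff[OF S] using acts r(1) by blast
qed

lemma has_point_group_Omega_t:
  assumes "tiling T" "repetitive T" "has_point_group T G" "S \<in> Omega_t T"
  shows "has_point_group S G"
  using has_point_group_same_patches[of T S G] repetitive_imp_fits[OF assms(1,2,4)] assms
  by (simp add: Omega_t_iff)

lemma conjugate_subgroup_mem: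
  assumes h: "rotation_matrix h"
  shows "g \<in> conjugate_subgroup h G \<longleftrightarrow> transpose h ** g ** h \<in> G"
proof
  assume "g \<in> conjugate_subgroup h G"
  then obtain k where k: "k \<in> G" "g = h ** k ** transpose h"
    unfolding conjugate_subgroup_def by blast
  have "transpose h ** g ** h = (transpose h ** h) ** k ** (transpose h ** h)"
    unfolding k(2) by (simp add: matrix_mul_assoc)
  then show "transpose h ** g ** h \<in> G"
    using k(1) by (simp add: rotation_matrix_transpose_mult[OF h])
next
  assume "transpose h ** g ** h \<in> G"
  moreover have "h ** (transpose h ** g ** h) ** transpose h = (h ** transpose h) ** g ** (h ** transpose h)"
    by (simp add: matrix_mul_assoc)
  then have "g = h ** (transpose h ** g ** h) ** transpose h"
    by (simp add: rotation_matrix_transpose_mult[OF h])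
  ultimately show "g \<in> conjugate_subgroup h G"
    unfolding conjugate_subgroup_def by (metis image_eqI)
qed

lemma subgroup_conjugate_subgroup:
  assumes h: "rotation_matrix h" and G: "subgroup G SO"
  shows "subgroup (conjugate_subgroup h G) SO"
  unfolding subgroup_SO_iff
proof (intro conjI ballI)
  have G': "\<And>A. A \<in> G \<Longrightarrow> rotation_matrix A" "mat 1 \<in> G"
    "\<And>A B. A \<in> G \<Longrightarrow> B \<in> G \<Longrightarrow> A ** B \<in> G" "\<And>A. A \<in> G \<Longrightarrow> transpose A \<in> G"
    using G by (auto simp: subgroup_SO_iff)
  show "mat 1 \<in> conjugate_subgroup h G"
    using G'(2) by (simp add: conjugate_subgroup_mem[OF h] rotation_matrix_transpose_mult[OF h])
  fix A assume A: "A \<in> conjugate_subgroup h G"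
  then show "rotation_matrix A"
    using G'(1) h by (auto simp: conjugate_subgroup_def intro!: rotation_matrix_mult rotation_matrix_transpose)
  have "transpose (transpose h ** A ** h) \<in> G"
    using A G'(4) by (simp add: conjugate_subgroup_mem[OF h])
  then show "transpose A \<in> conjugate_subgroup h G"
    by (simp add: conjugate_subgroup_mem[OF h] matrix_transpose_mul matrix_mul_assoc)
  fix B assume B: "B \<in> conjugate_subgroup h G"
  have "(transpose h ** A ** h) ** (transpose h ** B ** h) \<in> G"
    using A B G'(3) by (simp add: conjugate_subgroup_mem[OF h])
  moreover have "(transpose h ** A ** h) ** (transpose h ** B ** h) =
      transpose h ** A ** (h ** transpose h) ** B ** h"
    by (simp add: matrix_mul_assoc)
  ultimately show "A ** B \<in> conjugate_subgroup h G"
    by (simp add: conjugate_subgroup_mem[OF h] rotation_matrix_transpose_mult[OF h] matrix_mul_assoc)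
qed

lemma has_point_group_move:
  assumes T: "tiling T" and G: "has_point_group T G" and h: "rotation_matrix h"
  shows "has_point_group (move (motion h w) T) (conjugate_subgroup h G)"
proof -
  let ?T = "move (motion h w) T"
  have fits_iff: "fits ?T g (move (motion h w) P) \<longleftrightarrow> fits T (transpose h ** g ** h) P"
    for g P
    using h by (simp add: fits_move_tiling fits_move matrix_mul_assoc)
  have G': "finite G" "subgroup G SO" "\<And>g P. g \<in> G \<Longrightarrow> finite P \<Longrightarrow> P \<subseteq> T \<Longrightarrow> fits T g P"
    using G by (auto simp: has_point_group_def acts_by_rotations_iff)
  have sub: "subgroup (conjugate_subgroup h G) SO"
    using h G'(2) by (rule subgroup_conjugate_subgroup)
  have "fits ?T g P" if g: "g \<in> conjugate_subgroup h G" and P: "finite P" "P \<subseteq> ?T" for g P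
  proof -
    define P0 where "P0 = move (motion (transpose h) (- (transpose h *v w))) P"
    have P0: "P = move (motion h w) P0"
      by (simp add: P0_def move_motion_inverse(1)[OF h])
    have "P0 \<subseteq> T"
      using move_mono[OF P(2), of "motion (transpose h) (- (transpose h *v w))"]
      by (simp add: P0_def move_motion_inverse(2)[OF h])
    moreover have "finite P0"
      using P(1) by (simp add: P0_def move_def)
    moreover have "transpose h ** g ** h \<in> G"
      using g by (simp add: conjugate_subgroup_mem[OF h])
    ultimately have "fits T (transpose h ** g ** h) P0"
      using G'(3) by blast
    then show ?thesis
      by (simp add: P0 fits_iff)
  qed
  then have acts: "acts_by_rotations (conjugate_subgroup h G) ?T"
    using sub G'(1) by (simp add: acts_by_rotations_iff conjugate_subgroup_def)
  obtain r where r: "r > 0" "\<And>x g. rotation_matrix g \<Longrightarrow> fits T g (patch_at T r x) \<Longrightarrow> g \<in> G"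
    using G unfolding has_point_group_iff[OF T] by blast
  have "g \<in> conjugate_subgroup h G" if g: "rotation_matrix g" and fit: "fits ?T g (patch_at ?T r x)" for g x
  proof -
    obtain x0 where "x = motion h w x0"
      using bij_motion[OF h] by (metis bij_pointE)
    then have "fits T (transpose h ** g ** h) (patch_at T r x0)"
      using fit by (simp add: patch_at_move[OF h] fits_iff)
    then have "transpose h ** g ** h \<in> G"
      using r(2) g h by (simp add: rotation_matrix_mult rotation_matrix_transpose)
    then show ?thesis
      by (simp add: conjugate_subgroup_mem[OF h])
  qed
  then show ?thesis
    unfolding has_point_group_iff[OF tiling_move[OF h T]] using acts r(1) by blast
qed

text \<open>The rotations for which the patch of \<open>S\<close> of radius \<open>n\<close> around the origin fits into \<open>T\<close> again
  form a decreasing sequence of finite sets, this time nonempty ones, so that one rotation works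
  for all patches of \<open>S\<close>.\<close>

lemma Omega_r_rotation:
  fixes T :: "('n::finite, 'l) tiling"
  assumes T: "tiling T" and S: "S \<in> Omega_r T"
  obtains A where "rotation_matrix A" "move (motion A 0) S \<in> Omega_t T"
proof -
  have tS: "tiling S"
    using S by (simp add: Omega_r_def)
  define H where "H n = {A. rotation_matrix A \<and> fits T A (patch_at S (real n) 0)}" for n
  have ne: "H n \<noteq> {}" for n
  proof -
    have "patch S (patch_at S (real n) 0)"
      using finite_patch_at[OF tS] by (auto simp: patch_def patch_at_def)
    then obtain f where f: "rigid_motion f" "move f (patch_at S (real n) 0) \<subseteq> T"
      using S by (auto simp: Omega_r_def appears_up_to_rigid_motion_def patch_def)
    obtain A v where A: "rotation_matrix A" "f = motion A v"
      using rigid_motion_eq_motion[OF f(1)] .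
    then have "A \<in> H n"
      using f(2) unfolding H_def fits_def by blast
    then show ?thesis
      by blast
  qed
  have mono: "patch_at S (real m) 0 \<subseteq> patch_at S (real n) 0" if "m \<le> n" for m n
    using subset_cball[of "real m" "real n" "0 :: real^'n"] that by (auto simp: patch_at_def)
  then have "antimono H"
    unfolding H_def by (intro antimonoI) (use fits_mono in blast)
  moreover have "finite (H 0)"
    by (rule finite_subset[OF _ finite_rotations_fits[OF tS T]]) (auto simp: H_def)
  ultimately obtain n where n: "\<And>m. m \<ge> n \<Longrightarrow> H m = H n"
    using antimono_finite_stabilizes by blast
  obtain A where A: "A \<in> H n"
    using ne by blast
  then have rot: "rotation_matrix A"
    by (simp add: H_def)
  have "move (motion A 0) S \<in> Omega_t T"
    unfolding Omega_t_iff
  proof (intro conjI allI impI)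
    show "tiling (move (motion A 0) S)"
      by (rule tiling_move[OF rot tS])
    fix P assume P: "finite P" "P \<subseteq> move (motion A 0) S"
    define P0 where "P0 = move (motion (transpose A) (- (transpose A *v 0))) P"
    have P0: "P = move (motion A 0) P0"
      by (simp only: P0_def move_motion_inverse(1)[OF rot])
    have "P0 \<subseteq> S"
      using move_mono[OF P(2), of "motion (transpose A) (- (transpose A *v 0))"]
      by (simp only: P0_def move_motion_inverse(2)[OF rot])
    moreover have "finite P0"
      using P(1) by (simp add: P0_def move_def)
    ultimately obtain r where r: "r > 0" "P0 \<subseteq> patch_at S r 0" "\<And>t. t \<in> P0 \<Longrightarrow> fst t \<subseteq> cball 0 r"
      using finite_subset_patch_at[OF tS] by metis
    obtain k :: nat where k: "r \<le> real k"
      using real_arch_simple by blast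
    have "patch_at S r 0 \<subseteq> patch_at S (real (max k n)) 0"
      using subset_cball[of r "real (max k n)" "0 :: real^'n"] k by (auto simp: patch_at_def)
    moreover have "A \<in> H (max k n)"
      using n[of "max k n"] A by simp
    then have "fits T A (patch_at S (real (max k n)) 0)"
      by (simp add: H_def)
    ultimately have "fits T A P0"
      using r(2) fits_mono by blast
    then show "fits T (mat 1) P"
      by (simp add: P0 fits_move)
  qed
  then show thesis
    by (rule that[OF rot])
qed

lemma has_point_group_Omega_r:
  assumes T: "tiling T" and rep: "repetitive T" and G: "has_point_group T G" and S: "S \<in> Omega_r T"
  shows "\<exists>h\<in>carrier SO. has_point_group S (conjugate_subgroup h G)"
proof -
  obtain A where A: "rotation_matrix A" "move (motion A 0) S \<in> Omega_t T"
    using Omega_r_rotation[OF T S] .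
  have "has_point_group (move (motion A 0) S) G"
    by (rule has_point_group_Omega_t[OF T rep G A(2)])
  moreover have "tiling (move (motion A 0) S)"
    using A(2) by (simp add: Omega_t_iff)
  ultimately have "has_point_group (move (motion (transpose A) (- (transpose A *v 0))) (move (motion A 0) S))
      (conjugate_subgroup (transpose A) G)"
    by (intro has_point_group_move rotation_matrix_transpose[OF A(1)])
  then have "has_point_group S (conjugate_subgroup (transpose A) G)"
    by (simp only: move_motion_inverse(2)[OF A(1)])
  then show ?thesis
    using rotation_matrix_transpose[OF A(1)] by (auto simp: carrier_SO)
qed

lemma conjugate_subgroup_card_2:
  fixes h :: "real^'n^'n::finite"
  assumes "CARD('n) = 2" "rotation_matrix h" "subgroup G SO"
  shows "conjugate_subgroup h G = G"
proof -
  have "transpose h ** g ** h = g" if g: "rotation_matrix g" for g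
  proof -
    have "transpose h ** g ** h = g ** (transpose h ** h)"
      using rotation_matrix_commute_card_2[OF assms(1) rotation_matrix_transpose[OF assms(2)] g]
      by (simp add: matrix_mul_assoc)
    then show ?thesis
      by (simp add: rotation_matrix_transpose_mult[OF assms(2)])
  qed
  moreover have "rotation_matrix g" if "g \<in> G \<or> g \<in> conjugate_subgroup h G" for g
    using that assms(3) subgroup_conjugate_subgroup[OF assms(2,3)] unfolding subgroup_SO_iff by blast
  ultimately show ?thesis
    using conjugate_subgroup_mem[OF assms(2)] by (metis subsetI subset_antisym)
qed

theorem proposition3p8:
  fixes T :: "('n::finite, 'l) tiling"
  assumes "CARD('n) \<ge> 2" and "tiling T" and "flc T"
  shows "(repetitive T \<longleftrightarrow> minimal_system (Omega_t T)) \<and>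
    (repetitive T \<longrightarrow>
      (\<exists>G. has_point_group T G \<and>
        (\<forall>S\<in>Omega_r T. \<exists>h\<in>carrier SO. has_point_group S (conjugate_subgroup h G)) \<and>
        (\<forall>S\<in>Omega_t T. has_point_group S G) \<and>
        (CARD('n) = 2 \<longrightarrow> (\<forall>S\<in>Omega_r T. has_point_group S G))))"
proof (intro conjI impI)
  show "repetitive T \<longleftrightarrow> minimal_system (Omega_t T)"
    using assms(2,3) by (rule repetitive_iff_minimal)
  assume rep: "repetitive T"
  obtain G where G: "has_point_group T G"
    using repetitive_has_point_group[OF assms(2) rep] .
  then have sub: "subgroup G SO"
    by (simp add: has_point_group_def acts_by_rotations_def)
  note Omega_r = has_point_group_Omega_r[OF assms(2) rep G]
  have "has_point_group S G" if card: "CARD('n) = 2" and S: "S \<in> Omega_r T" for S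
  proof -
    obtain h where h: "h \<in> carrier SO" "has_point_group S (conjugate_subgroup h G)"
      using Omega_r[OF S] by blast
    then show ?thesis
      using conjugate_subgroup_card_2[OF card _ sub, of h] by (simp add: carrier_SO)
  qed
  then show "\<exists>G. has_point_group T G \<and>
      (\<forall>S\<in>Omega_r T. \<exists>h\<in>carrier SO. has_point_group S (conjugate_subgroup h G)) \<and>
      (\<forall>S\<in>Omega_t T. has_point_group S G) \<and>
      (CARD('n) = 2 \<longrightarrow> (\<forall>S\<in>Omega_r T. has_point_group S G))"
    using G Omega_r has_point_group_Omega_t[OF assms(2) rep G] by blast
qed

end
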